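(* Let $\alpha\ge J(K^\star)$. For all $K$ in the sublevel set $\mathbb{K}_\alpha$, the norm of the Hessian of the cost function is bounded: $\|\nabla^2J(\mathrm{vec}(K))\|\le L$, where $$L=\frac{2\alpha}{\sigma_{\min}(Q)}\left(\|R\|+\frac{\alpha}{\mu}\Big(1+\frac{2\zeta_1}{\|B\|\|C\|}\Big)\|B\|^2\right)\|C\|^2$$ with $$\zeta_1=\frac{1}{\sigma_{\min}(Q)}\left(\frac{\alpha}{\mu}\big(1+\|B\|^2\|C\|^2\big)+\|R\|\|C\|^2\right)-1 .$$
   Context: Setting (static output feedback, SOF). $A\in\mathbb{R}^{n\times n}$, $B\in\mathbb{R}^{n\times m}$, $C\in\mathbb{R}^{d\times n}$; $(A,B)$ is controllable, $(C,A)$ is observable, and $C$ has linearly independent rows. $Q\in\mathbb{R}^{n\times n}$ and $R\in\mathbb{R}^{m\times m}$ are symmetric positive definite. $\mathcal{D}$ is a probability distribution on $\mathbb{R}^n$ with $X_0:=\mathbb{E}_{x_0\sim\mathcal{D}}[x_0x_0^\top]\succ 0$, and $\mu:=\sigma_{\min}(X_0)>0$. For $K\in\mathbb{R}^{m\times d}$ put $\mathcal{A}_K:=A-BKC$. The set of stabilizing gains is $\mathbb{K}:=\{K\in\mathbb{R}^{m\times d}:\rho(\mathcal{A}_K)<1\}$ ($\rho$ is the spectral radius), assumed nonempty. For $K\in\mathbb{K}$, $$J(K):=\mathbb{E}_{x_0\sim\mathcal{D}}\Big[\sum_{t=0}^\infty x_t^\top(Q+C^\top K^\top RKC)x_t\Big],\quad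 x_{t+1}=\mathcal{A}_Kx_t .$$ Equivalently $J(K)=\mathrm{Tr}(P_KX_0)$, where $P_K=Q+C^\top K^\top RKC+\mathcal{A}_K^\top P_K\mathcal{A}_K$. $K^\star$ is a global minimizer of $J$ over $\mathbb{K}$, and $\mathbb{K}_\alpha:=\{K\in\mathbb{K}:J(K)\le\alpha\}$. $\nabla^2J(\mathrm{vec}(K))\in\mathbb{R}^{md\times md}$ is the Hessian of $J$ viewed as a function of the vectorization $\mathrm{vec}(K)$. $\|\cdot\|$ is the induced 2-norm and $\sigma_{\min}$ the minimal singular value. *)

theory Defs
  imports "HOL-Probability.Probability"
begin

section \<open>Matrices\<close>

definition mat_norm :: "real^'n^'m \<Rightarrow> real"
  where "mat_norm M = onorm (\<lambda>x. M *v x)"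

definition pos_def_mat :: "real^'n^'n \<Rightarrow> bool"
  where "pos_def_mat M \<longleftrightarrow> transpose M = M \<and> (\<forall>x. x \<noteq> 0 \<longrightarrow> x \<bullet> (M *v x) > 0)"

text \<open>The singular values are the square roots of the eigenvalues of \<open>M\<^sup>T M\<close>; real
  eigenvectors suffice because that matrix is symmetric.\<close>

definition singular_values :: "real^'n^'n \<Rightarrow> real set"
  where "singular_values M =
    {s. s \<ge> 0 \<and> (\<exists>v. v \<noteq> 0 \<and> (transpose M ** M) *v v = s\<^sup>2 *s v)}"

definition sigma_min :: "real^'n^'n \<Rightarrow> real"
  where "sigma_min M = Min (singular_values M)"

text \<open>Eigenvalues of a real matrix are taken over the complex numbers.\<close>

definition complex_eigenvalues :: "real^'n^'n \<Rightarrow> complex set"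
  where "complex_eigenvalues M =
    {z. \<exists>v::complex^'n. v \<noteq> 0 \<and> map_matrix complex_of_real M *v v = z *s v}"

definition spectral_radius :: "real^'n^'n \<Rightarrow> real"
  where "spectral_radius M = Max (cmod ` complex_eigenvalues M)"

text \<open>Injectivity is required because \<^const>\<open>rows\<close> is a set and forgets repeated rows.\<close>

definition lin_indep_rows :: "real^'n^'d \<Rightarrow> bool"
  where "lin_indep_rows C \<longleftrightarrow> inj (\<lambda>i. row i C) \<and> independent (rows C)"


section \<open>Linear systems with static output feedback\<close>

text \<open>\<open>((**) A ^^ k) B\<close> is \<open>A\<^sup>k B\<close>. The Kalman matrix \<open>[B, AB, \<dots>, A\<^sup>n\<^sup>-\<^sup>1 B]\<close> is given by the
  set of its columns, so the dimension below is its rank; dually for observability, with the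
  rows of the \<open>C A\<^sup>k\<close>.\<close>

definition controllable :: "real^'n^'n \<Rightarrow> real^'m^'n \<Rightarrow> bool"
  where "controllable A B \<longleftrightarrow>
    dim (\<Union>k<CARD('n). columns (((**) A ^^ k) B)) = CARD('n)"

definition observable :: "real^'n^'d \<Rightarrow> real^'n^'n \<Rightarrow> bool"
  where "observable C A \<longleftrightarrow>
    dim (\<Union>k<CARD('n). rows (((\<lambda>M. M ** A) ^^ k) C)) = CARD('n)"

definition closed_loop ::
  "real^'n^'n \<Rightarrow> real^'m^'n \<Rightarrow> real^'n^'d \<Rightarrow> real^'d^'m \<Rightarrow> real^'n^'n"
  where "closed_loop A B C K = A - B ** K ** C"

definition stabilizing ::
  "real^'n^'n \<Rightarrow> real^'m^'n \<Rightarrow> real^'n^'d \<Rightarrow> (real^'d^'m) set"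
  where "stabilizing A B C = {K. spectral_radius (closed_loop A B C K) < 1}"

definition trajectory ::
  "real^'n^'n \<Rightarrow> real^'m^'n \<Rightarrow> real^'n^'d \<Rightarrow> real^'d^'m \<Rightarrow> real^'n \<Rightarrow> nat \<Rightarrow> real^'n"
  where "trajectory A B C K x0 t = ((\<lambda>x. closed_loop A B C K *v x) ^^ t) x0"

definition stage_weight ::
  "real^'n^'d \<Rightarrow> real^'n^'n \<Rightarrow> real^'m^'m \<Rightarrow> real^'d^'m \<Rightarrow> real^'n^'n"
  where "stage_weight C Q R K = Q + transpose C ** transpose K ** R ** K ** C"

text \<open>Only the values on stabilizing gains are meaningful: elsewhere the series may diverge and
  \<^const>\<open>suminf\<close> and the integral return arbitrary values.\<close>

definition sof_cost ::
  "(real^'n) measure \<Rightarrow> real^'n^'n \<Rightarrow> real^'m^'n \<Rightarrow> real^'n^'d \<Rightarrow>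
    real^'n^'n \<Rightarrow> real^'m^'m \<Rightarrow> real^'d^'m \<Rightarrow> real"
  where "sof_cost D A B C Q R K =
    (LINT x0|D. (\<Sum>t. trajectory A B C K x0 t \<bullet>
       (stage_weight C Q R K *v trajectory A B C K x0 t)))"

definition sublevel_gains ::
  "(real^'n) measure \<Rightarrow> real^'n^'n \<Rightarrow> real^'m^'n \<Rightarrow> real^'n^'d \<Rightarrow>
    real^'n^'n \<Rightarrow> real^'m^'m \<Rightarrow> real \<Rightarrow> (real^'d^'m) set"
  where "sublevel_gains D A B C Q R \<alpha> = {K \<in> stabilizing A B C. sof_cost D A B C Q R K \<le> \<alpha>}"

definition outer_square :: "real^'n \<Rightarrow> real^'n^'n"
  where "outer_square x = (\<chi> i j. x $ i * x $ j)"

definition second_moment :: "(real^'n) measure \<Rightarrow> real^'n^'n"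
  where "second_moment D = (LINT x|D. outer_square x)"


section \<open>Vectorization and Hessian\<close>

text \<open>The component \<open>(j, i)\<close> of \<open>vec K\<close> is \<open>K\<^sub>i\<^sub>j\<close>, the column index coming first as in column
  stacking.\<close>

definition vectorize :: "real^'d^'m \<Rightarrow> real^('d \<times> 'm)"
  where "vectorize K = (\<chi> p. K $ snd p $ fst p)"

definition unvectorize :: "real^('d \<times> 'm) \<Rightarrow> real^'d^'m"
  where "unvectorize v = (\<chi> i j. v $ (j, i))"

lemma unvectorize_vectorize [simp]: "unvectorize (vectorize K) = K"
  by (simp add: vectorize_def unvectorize_def vec_eq_iff)

lemma vectorize_unvectorize [simp]: "vectorize (unvectorize v) = v"
  by (simp add: vectorize_def unvectorize_def vec_eq_iff)

text \<open>The Hessian is the Jacobian matrix of the gradient field \<open>g\<close>, which has to exist near the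
  point and be differentiable at it.\<close>

definition has_hessian :: "(real^'k \<Rightarrow> real) \<Rightarrow> real^'k^'k \<Rightarrow> real^'k \<Rightarrow> bool"
  where "has_hessian f H x \<longleftrightarrow>
    (\<exists>g. (\<forall>\<^sub>F y in nhds x. (f has_derivative (\<lambda>h. g y \<bullet> h)) (at y)) \<and>
         (g has_derivative (\<lambda>h. H *v h)) (at x))"

definition hessian :: "(real^'k \<Rightarrow> real) \<Rightarrow> real^'k \<Rightarrow> real^'k^'k"
  where "hessian f x = (THE H. has_hessian f H x)"

lemma has_hessian_unique:
  assumes "has_hessian f H x" "has_hessian f H' x"
  shows "H = H'"
proof -
  obtain g where g: "\<forall>\<^sub>F y in nhds x. (f has_derivative (\<lambda>h. g y \<bullet> h)) (at y)"
    and dg: "(g has_derivative (\<lambda>h. H *v h)) (at x)"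
    using assms(1) unfolding has_hessian_def by blast
  obtain g' where g': "\<forall>\<^sub>F y in nhds x. (f has_derivative (\<lambda>h. g' y \<bullet> h)) (at y)"
    and dg': "(g' has_derivative (\<lambda>h. H' *v h)) (at x)"
    using assms(2) unfolding has_hessian_def by blast
  have eq: "\<forall>\<^sub>F y in nhds x. g y = g' y"
    using g g'
  proof eventually_elim
    case (elim y)
    have "(\<lambda>h. g y \<bullet> h) = (\<lambda>h. g' y \<bullet> h)"
      using elim by (rule has_derivative_unique)
    then show ?case
      by (metis vector_eq_rdot inner_commute)
  qed
  then have "\<forall>\<^sub>F y in at x. g y = g' y" and "g x = g' x"
    by (auto simp: eventually_at_filter elim: eventually_mono dest: eventually_nhds_x_imp_x)
  then have "(g' has_derivative (\<lambda>h. H *v h)) (at x)"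
    using has_derivative_transform_eventually[OF dg] by simp
  then have "(\<lambda>h. H *v h) = (\<lambda>h. H' *v h)"
    using dg' by (rule has_derivative_unique)
  then show ?thesis
    by (simp add: matrix_eq fun_eq_iff)
qed

lemma hessian_eqI: "has_hessian f H x \<Longrightarrow> hessian f x = H"
  unfolding hessian_def using has_hessian_unique by blast

end

(*
  Since J(K) = tr(P X0), differentiating the Lyapunov equation of P gives the gradient
  2 (R K C - B^T P A_K) X C^T, where X solves X = A_K X A_K^T + X0.  Differentiating once more and
  eliminating the derivative of X by duality of the two Lyapunov equations, the Hessian is
    2 tr(E^T (R + B^T P B) F C X C^T) - 2 tr(E^T B^T P'[F] A_K X C^T) - 2 tr(F^T B^T P'[E] A_K X C^T).
  On the sublevel set ||P|| <= alpha / mu and tr X <= alpha / sigma_min Q.  Completing squares in the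
  source of the Lyapunov equation of P'[E], for unit E, yields -zeta1 P <= P'[E] <= zeta1 P, and each
  trace is bounded by Cauchy-Schwarz in the semi-inner product tr(U^T V X), in which A_K has squared
  norm tr(X - X0) <= tr X.

  That spectral radius < 1 forces A^t -> 0 follows by factoring an annihilating polynomial of least
  degree, whose roots are eigenvalues: each linear factor is a first-order linear recursion.
*)

theory Submission
  imports Defs "HOL-Computational_Algebra.Fundamental_Theorem_Algebra"
begin

section \<open>Spectral radius and convergence of powers\<close>


text \<open>The cost is an integral of a series that is meaningful only on stabilizing gains, while
  a Hessian requires a gradient on a whole neighbourhood. So the stabilizing set must be open: the
  quadratic Lyapunov function of one stable matrix still decreases along every nearby matrix, and
  this forces spectral radius < 1. Differentiability of P and X then comes from a general fact about
  solutions of linear equations whose operator depends on a parameter. In zeta1 the terms with |B|^2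
  |C|^2 and |R| |C|^2 are the squares belonging to the perturbation E, the lone alpha / mu bounds
  x^T P x, and the final -1 is the term - x^T Q x left over by the Lyapunov equation of P; division
  by sigma_min Q makes the bound relative to Q. The Euclidean norm of vec K is the Frobenius norm of
  K, so the Hessian is tested on E and F of Frobenius norm 1. Coefficients are measured in operator
  norm, which keeps dimensions out of L. The norm of A_K does not occur in L, which is why A_K is
  measured through X.\<close>

definition stable :: "real^'n^'n \<Rightarrow> bool"
  where "stable A \<longleftrightarrow> (\<forall>x. (\<lambda>t. (((*v) A) ^^ t) x) \<longlonglongrightarrow> 0)"

section \<open>Polynomials in a complex matrix\<close>

definition poly_mat :: "complex poly \<Rightarrow> complex^'n^'n \<Rightarrow> complex^'n^'n"
  where "poly_mat p M = fold_coeffs (\<lambda>a W. mat a + M ** W) p 0"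

lemma mat_mult_vector [simp]: "mat (a::'a::comm_semiring_1) *v v = a *s v"
  by (simp add: vec_eq_iff mat_def matrix_vector_mult_def if_distrib if_distribR cong: if_cong)

lemma mat_mult_commute: "mat (a::'a::field) ** M = M ** mat a"
  by (simp add: matrix_eq vector_scalar_commute flip: matrix_vector_mul_assoc)

lemma mat_add: "mat (a + b) = mat a + mat (b::'a::monoid_add)"
  by (vector mat_def)

lemma mat_mult_mat: "mat a ** mat b = mat (a * b::'a::comm_semiring_1)"
  by (simp add: matrix_eq flip: matrix_vector_mul_assoc)

lemma poly_mat_0 [simp]: "poly_mat 0 M = 0"
  by (simp add: poly_mat_def)

lemma poly_mat_pCons [simp]: "poly_mat (pCons a p) M = mat a + M ** poly_mat p M"
  by (cases "p = 0 \<and> a = 0") (auto simp: poly_mat_def matrix_eq algebra_simps simp flip: matrix_vector_mul_assoc)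

lemma poly_mat_add: "poly_mat (p + q) M = poly_mat p M + poly_mat q M"
  by (induction p q rule: poly_induct2) (simp_all add: mat_add matrix_add_ldistrib)

lemma poly_mat_smult: "poly_mat (smult c p) M = mat c ** poly_mat p M"
  by (induction p)
    (simp_all add: matrix_add_ldistrib mat_mult_mat matrix_mul_assoc mat_mult_commute[of c M])

text \<open>Splits off one root. With w the value of the cofactor at v, this is an eigenvector
  equation for w if the product annihilates v, and a one-step recursion for w in general.\<close>

lemma poly_mat_linear_factor:
  "poly_mat ([:-z, 1:] * p) M *v v = M *v (poly_mat p M *v v) - z *s (poly_mat p M *v v)"
proof -
  have "[:-z, 1:] * p = pCons 0 p + smult (-z) p" by simp
  then show ?thesis
    by (simp only: poly_mat_add poly_mat_smult poly_mat_pCons)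
      (simp add: algebra_simps vector_smult_lneg flip: matrix_vector_mul_assoc)
qed

lemma poly_mat_eigenvector:
  assumes "M *v v = z *s v"
  shows "poly_mat p M *v v = poly p z *s v"
proof (induction p)
  case (pCons a p)
  have "M *v (poly p z *s v) = poly p z *s (z *s v)"
    using assms by (metis vector_scalar_commute)
  with pCons show ?case
    by (simp add: vector_smult_assoc vector_sadd_rdistrib matrix_vector_mult_add_rdistrib mult.commute
        flip: matrix_vector_mul_assoc)
qed simp

text \<open>\<open>span\<close> is the real span, since complex matrices serve here as a real
  Euclidean space. The degree is bounded by vanishing coefficients so that \<open>k = 0\<close>
  yields the zero polynomial.\<close>

lemma span_poly_mat:
  assumes "X \<in> span ((\<lambda>i. poly_mat (monom 1 i) M) ` {..<k})"
  shows "\<exists>p. (\<forall>i\<ge>k. coeff p i = 0) \<and> X = poly_mat p M"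
  using assms
proof (induction rule: span_induct_alt)
  case base
  show ?case by (rule exI[of _ 0]) simp
next
  case (step c Y Z)
  then obtain i p where i: "i < k" "Y = poly_mat (monom 1 i) M"
    and p: "\<forall>i\<ge>k. coeff p i = 0" "Z = poly_mat p M" by auto
  have "c *\<^sub>R Y = mat (complex_of_real c) ** Y"
    by (simp add: matrix_eq flip: matrix_vector_mul_assoc)
      (vector matrix_vector_mult_def, simp add: scaleR_sum_right sum_distrib_left mult.assoc scaleR_conv_of_real)
  then have "c *\<^sub>R Y + Z = poly_mat (smult (of_real c) (monom 1 i) + p) M"
    using i p by (simp add: poly_mat_add poly_mat_smult)
  then show ?case using i p by (intro exI[of _ "smult (of_real c) (monom 1 i) + p"]) auto
qed

text \<open>If no power of M fell into the span of the earlier ones, they would form independent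
  sets of every size, against finite dimension. A dependence of M^k on lower powers, moved to one
  side, has coefficient 1 at k and so is a nonzero polynomial.\<close>

lemma annihilating_poly_exists: "\<exists>p\<noteq>0. poly_mat p (M :: complex^'n^'n) = 0"
proof -
  let ?f = "\<lambda>i. poly_mat (monom 1 i) M"
  have "\<exists>k. ?f k \<in> span (?f ` {..<k})"
  proof (rule ccontr)
    assume "\<not> ?thesis"
    then have n: "?f k \<notin> span (?f ` {..<k})" for k by blast
    have "independent (?f ` {..<k}) \<and> card (?f ` {..<k}) = k" for k
    proof (induction k)
      case (Suc k)
      have "?f k \<notin> ?f ` {..<k}" using n[of k] span_base by (rule contrapos_nn)
      moreover have "independent (insert (?f k) (?f ` {..<k}))"
        using n[of k] Suc by (intro independent_insertI) auto
      ultimately show ?case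
        using Suc by (simp only: lessThan_Suc image_insert card_insert_disjoint finite_imageI finite_lessThan simp_thms)
    qed (simp add: independent_empty)
    from this[of "Suc DIM(complex^'n^'n)"] show False
      using independent_bound[of "?f ` {..<Suc DIM(complex^'n^'n)}"] by linarith
  qed
  then obtain k p where p: "\<forall>i\<ge>k. coeff p i = 0" "?f k = poly_mat p M"
    using span_poly_mat by blast
  have "coeff (monom 1 k + smult (-1) p) k \<noteq> 0" using p by simp
  then have "monom 1 k + smult (-1) p \<noteq> 0" by force
  moreover have "poly_mat (monom 1 k + smult (-1) p) M = 0"
    using p(2) by (simp only: poly_mat_add poly_mat_smult)
     (simp add: matrix_eq algebra_simps vector_smult_lneg flip: matrix_vector_mul_assoc)
  ultimately show ?thesis by blast
qed

text \<open>For a root z the cofactor q has smaller degree, so minimality gives some v with q(M) v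
  nonzero, and (M - z) q(M) v = 0 makes this vector an eigenvector.\<close>

lemma minimal_poly_exists:
  obtains p where "p \<noteq> 0" "poly_mat p M = 0"
    "\<And>z. poly p z = 0 \<Longrightarrow> \<exists>v\<noteq>0. M *v v = z *s v"
proof -
  obtain p where p: "p \<noteq> 0" "poly_mat p M = 0"
    and min: "\<And>q. q \<noteq> 0 \<Longrightarrow> poly_mat q M = 0 \<Longrightarrow> degree p \<le> degree q"
    using ex_has_least_nat[of "\<lambda>p. p \<noteq> 0 \<and> poly_mat p M = 0" _ degree]
      annihilating_poly_exists[of M] by blast
  have "\<exists>v\<noteq>0. M *v v = z *s v" if z: "poly p z = 0" for z
  proof -
    obtain q where q: "p = [:-z, 1:] * q" using z by (auto simp: poly_eq_0_iff_dvd)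
    have "q \<noteq> 0" using p q by auto
    moreover have "degree q < degree p" using \<open>q \<noteq> 0\<close> by (simp add: q degree_mult_eq del: mult_pCons_left)
    ultimately have "poly_mat q M \<noteq> 0" using min by force
    then obtain v where v: "poly_mat q M *v v \<noteq> 0"
      by (metis matrix_eq matrix_vector_mult_0)
    have "M *v (poly_mat q M *v v) - z *s (poly_mat q M *v v) = 0"
      using p(2) by (metis q poly_mat_linear_factor matrix_vector_mult_0)
    with v show ?thesis by auto
  qed
  with p that show ?thesis by blast
qed

text \<open>\<open>spectral_radius\<close> is a \<open>Max\<close>, which is informative only for a
  finite nonempty set. Every eigenvalue is a root of any annihilating polynomial.\<close>

lemma finite_complex_eigenvalues: "finite (complex_eigenvalues A)"
proof -
  let ?M = "map_matrix complex_of_real A"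
  obtain p where p: "p \<noteq> 0" "poly_mat p ?M = 0" using annihilating_poly_exists by blast
  have "complex_eigenvalues A \<subseteq> {z. poly p z = 0}"
  proof
    fix z assume "z \<in> complex_eigenvalues A"
    then obtain v where "v \<noteq> 0" "?M *v v = z *s v" by (auto simp: complex_eigenvalues_def)
    with poly_mat_eigenvector[OF this(2), of p] p show "z \<in> {z. poly p z = 0}" by simp
  qed
  then show ?thesis using poly_roots_finite[OF p(1)] finite_subset by blast
qed

lemma complex_eigenvalues_nonempty: "complex_eigenvalues (A :: real^'n^'n) \<noteq> {}"
proof -
  let ?M = "map_matrix complex_of_real A"
  obtain p where p: "p \<noteq> 0" "poly_mat p ?M = 0"
    "\<And>z. poly p z = 0 \<Longrightarrow> \<exists>v\<noteq>0. ?M *v v = z *s v"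
    using minimal_poly_exists by blast
  have "degree p \<noteq> 0"
  proof
    assume "degree p = 0"
    then obtain c where "p = [:c:]" by (metis degree_eq_zeroE)
    with p(1,2) have "c \<noteq> 0" "mat c = (0 :: complex^'n^'n)" by auto
    then show False by (simp add: vec_eq_iff mat_def) metis
  qed
  then obtain z where "poly p z = 0"
    using fundamental_theorem_of_algebra[of p] constant_degree[of p] by auto
  from p(3)[OF this] show ?thesis by (auto simp: complex_eigenvalues_def)
qed

lemma spectral_radius_less_iff:
  "spectral_radius A < r \<longleftrightarrow> (\<forall>z\<in>complex_eigenvalues A. cmod z < r)"
  unfolding spectral_radius_def
  using finite_complex_eigenvalues complex_eigenvalues_nonempty by (subst Max_less_iff) auto

lemma norm_vector_smult: "norm (z *s v) = norm z * norm (v :: 'a::real_normed_field^'n)"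
  by (simp add: norm_vec_def norm_mult L2_set_right_distrib)

lemma geometric_recursion_bound:
  fixes a :: "nat \<Rightarrow> real"
  assumes "\<And>t. a (Suc t) \<le> l * a t + c * r ^ t" "0 \<le> l" "l < r" "c \<ge> 0"
  shows "\<exists>k\<ge>0. \<forall>t. a t \<le> k * r ^ t"
proof -
  \<comment> \<open>Makes \<open>k * r ^ t\<close> a supersolution: it dominates \<open>a 0\<close>,
    and \<open>c <= k * (r - l)\<close> gives \<open>l * k + c <= k * r\<close>.\<close>
  define k where "k = max \<bar>a 0\<bar> (c / (r - l))"
  have k: "k \<ge> 0" "a 0 \<le> k" "c / (r - l) \<le> k"
    by (auto simp: k_def)
  then have c: "c \<le> k * (r - l)" using assms(3) by (simp add: pos_divide_le_eq)
  have "a t \<le> k * r ^ t" for t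
  proof (induction t)
    case (Suc t)
    have "a (Suc t) \<le> l * (k * r ^ t) + k * (r - l) * r ^ t"
      using assms(1)[of t] mult_left_mono[OF Suc assms(2)]
        mult_right_mono[OF c, of "r ^ t"] zero_le_power[of r t] assms(2,3) by linarith
    then show ?case by (simp add: algebra_simps)
  qed (use k in simp)
  with k show ?thesis by blast
qed

text \<open>Allowing p(M) v to decay instead of being 0 is what carries the induction: after a root
  z is split off, w = q(M) v obeys a recursion with factor z driven by p(M) v, hence decays too, and
  q has one degree less. Since all roots lie strictly inside radius \<open>r\<close>, repeated roots
  only enlarge the constant.\<close>

lemma poly_mat_geometric_decay:
  assumes "p \<noteq> 0" "\<And>z. poly p z = 0 \<Longrightarrow> cmod z < r" "0 < r" "c \<ge> 0"
    and "\<And>t. norm ((((*v) M) ^^ t) (poly_mat p M *v v)) \<le> c * r ^ t"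
  shows "\<exists>k\<ge>0. \<forall>t. norm ((((*v) M) ^^ t) v) \<le> k * r ^ t"
  using assms
proof (induction "degree p" arbitrary: p c)
  case 0
  then obtain a where a: "p = [:a:]" by (metis degree_eq_zeroE)
  then have "a \<noteq> 0" using 0 by auto
  have smult: "(((*v) M) ^^ t) (a *s v) = a *s ((((*v) M) ^^ t) v)" for t
    by (induction t) (simp_all add: vector_scalar_commute)
  have "norm ((((*v) M) ^^ t) v) \<le> c / cmod a * r ^ t" for t
    using 0(6)[of t] \<open>a \<noteq> 0\<close> by (simp add: a smult norm_vector_smult field_simps)
  moreover have "c / cmod a \<ge> 0" using 0 by simp
  ultimately show ?case by blast
next
  case (Suc n)
  obtain z where z: "poly p z = 0"
    using fundamental_theorem_of_algebra[of p] constant_degree[of p] Suc(2) by auto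
  obtain q where q: "p = [:-z, 1:] * q" using z by (auto simp: poly_eq_0_iff_dvd)
  have "q \<noteq> 0" using Suc q by auto
  then have deg: "n = degree q" using Suc(2) by (simp add: q degree_mult_eq del: mult_pCons_left)
  define w where "w = poly_mat q M *v v"
  have pw: "M *v w = z *s w + poly_mat p M *v v"
    by (simp only: q poly_mat_linear_factor w_def) simp
  have step: "(((*v) M) ^^ Suc t) w = z *s ((((*v) M) ^^ t) w) + (((*v) M) ^^ t) (poly_mat p M *v v)" for t
    by (induction t) (simp_all add: pw matrix_vector_right_distrib vector_scalar_commute)
  have "norm ((((*v) M) ^^ Suc t) w) \<le> cmod z * norm ((((*v) M) ^^ t) w) + c * r ^ t" for t
    unfolding step using norm_triangle_ineq Suc(7)[of t]
    by (smt (verit, best) norm_vector_smult)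
  from geometric_recursion_bound[of "\<lambda>t. norm ((((*v) M) ^^ t) w)", OF this]
  obtain k where "k \<ge> 0" "\<And>t. norm ((((*v) M) ^^ t) w) \<le> k * r ^ t"
    using Suc(4)[OF z] Suc(6) by auto
  moreover have "cmod y < r" if "poly q y = 0" for y using Suc(4)[of y] that by (simp add: q)
  ultimately show ?case using Suc(1)[OF deg \<open>q \<noteq> 0\<close>] Suc(5) unfolding w_def by blast
qed

lemma stable_if_spectral_radius:
  fixes A :: "real^'n^'n"
  assumes "spectral_radius A < 1"
  shows "stable A"
proof -
  let ?M = "map_matrix complex_of_real A"
  let ?c = "\<lambda>x::real^'n. (\<chi> i. complex_of_real (x $ i))"
  \<comment> \<open>A rate strictly above the spectral radius leaves room for repeated
    roots.\<close>
  obtain r where r: "spectral_radius A < r" "r < 1" using dense assms by blast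
  obtain p where p: "p \<noteq> 0" "poly_mat p ?M = 0"
    "\<And>z. poly p z = 0 \<Longrightarrow> \<exists>v\<noteq>0. ?M *v v = z *s v"
    using minimal_poly_exists by blast
  have ev: "\<forall>z\<in>complex_eigenvalues A. cmod z < r" using r spectral_radius_less_iff by blast
  have "0 < r" using ev complex_eigenvalues_nonempty[of A] norm_ge_zero le_less_trans by blast
  have powzero: "(((*v) M) ^^ t) 0 = 0" for t and M :: "complex^'n^'n" by (induction t) auto
  have "(\<lambda>t. (((*v) A) ^^ t) x) \<longlonglongrightarrow> 0" for x
  proof -
    have "\<exists>k\<ge>0. \<forall>t. norm ((((*v) ?M) ^^ t) (?c x)) \<le> k * r ^ t"
    proof (rule poly_mat_geometric_decay[OF p(1) _ \<open>0 < r\<close>, where c = 0])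
      show "cmod z < r" if "poly p z = 0" for z
        using p(3)[OF that] ev by (auto simp: complex_eigenvalues_def)
    qed (simp_all add: p powzero)
    then obtain k where k: "\<And>t. norm ((((*v) ?M) ^^ t) (?c x)) \<le> k * r ^ t" by blast
    have "?M *v ?c y = ?c (A *v y)" for y
      by (simp add: vec_eq_iff matrix_vector_mult_def)
    then have pow: "(((*v) ?M) ^^ t) (?c x) = ?c ((((*v) A) ^^ t) x)" for t
      by (induction t) auto
    have "(\<lambda>t. (((*v) A) ^^ t) x $ i) \<longlonglongrightarrow> 0" for i
    proof (rule Lim_null_comparison)
      have "norm ((((*v) A) ^^ t) x $ i) \<le> k * r ^ t" for t
        using k[of t] Finite_Cartesian_Product.norm_nth_le[of "?c ((((*v) A) ^^ t) x)" i] unfolding pow by simp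
      then show "\<forall>\<^sub>F t in sequentially. norm ((((*v) A) ^^ t) x $ i) \<le> k * r ^ t" by simp
      show "(\<lambda>t. k * r ^ t) \<longlonglongrightarrow> 0"
        using r \<open>0 < r\<close> by (intro tendsto_mult_right_zero LIMSEQ_realpow_zero) auto
    qed
    then show ?thesis by (simp add: vec_tendstoI)
  qed
  then show ?thesis by (simp add: stable_def)
qed

text \<open>For a complex eigenvector a + i b, the sum of the forms of \<open>Z\<close> at a and at
  b is multiplied by |z|^2 under \<open>A\<close>, as the mixed terms cancel; strict decrease gives
  |z| < 1. It is the tool for openness of the stabilizing set.\<close>

lemma spectral_radius_less_1_lyapunov:
  fixes A Z :: "real^'n^'n"
  assumes "\<And>x. 0 \<le> x \<bullet> (Z *v x)"
    and "\<And>x. x \<noteq> 0 \<Longrightarrow> (A *v x) \<bullet> (Z *v (A *v x)) < x \<bullet> (Z *v x)"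
  shows "spectral_radius A < 1"
proof -
  have "cmod z < 1" if z: "z \<in> complex_eigenvalues A" for z
  proof -
    from z obtain v where v: "v \<noteq> 0" "map_matrix complex_of_real A *v v = z *s v"
      by (auto simp: complex_eigenvalues_def)
    define a b where "a = (\<chi> i. Re (v $ i))" and "b = (\<chi> i. Im (v $ i))"
    have "a \<noteq> 0 \<or> b \<noteq> 0" using v(1) by (auto simp: a_def b_def vec_eq_iff complex_eq_iff)
    have ReIm: "(map_matrix complex_of_real A *v v) $ i = Complex ((A *v a) $ i) ((A *v b) $ i)" for i
      by (simp add: complex_eq_iff matrix_vector_mult_def a_def b_def)
    have "A *v a = Re z *\<^sub>R a - Im z *\<^sub>R b \<and> A *v b = Im z *\<^sub>R a + Re z *\<^sub>R b"
      using ReIm unfolding v(2) by (simp add: vec_eq_iff complex_eq_iff a_def b_def algebra_simps)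
    then have Aa: "A *v a = Re z *\<^sub>R a - Im z *\<^sub>R b" and Ab: "A *v b = Im z *\<^sub>R a + Re z *\<^sub>R b"
      using ReIm unfolding v(2) by (simp_all add: vec_eq_iff complex_eq_iff a_def b_def)
    define q where "q = a \<bullet> (Z *v a) + b \<bullet> (Z *v b)"
    have "(A *v a) \<bullet> (Z *v (A *v a)) + (A *v b) \<bullet> (Z *v (A *v b)) = (cmod z)\<^sup>2 * q"
      unfolding Aa Ab q_def cmod_power2
      by (simp add: algebra_simps inner_simps power2_eq_square)
    moreover have "(A *v a) \<bullet> (Z *v (A *v a)) + (A *v b) \<bullet> (Z *v (A *v b)) < q"
      unfolding q_def using assms(2)[of a] assms(2)[of b] \<open>a \<noteq> 0 \<or> b \<noteq> 0\<close>
      by (cases "a = 0"; cases "b = 0"; simp)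
    ultimately have "(cmod z)\<^sup>2 * q < 1 * q" by simp
    moreover have "q \<ge> 0" using assms(1) by (simp add: q_def)
    ultimately have "(cmod z)\<^sup>2 < 1" using mult_less_cancel_right by (metis not_le)
    then show ?thesis by (simp add: abs_square_less_1)
  qed
  then show ?thesis by (simp add: spectral_radius_less_iff)
qed

section \<open>Matrices and quadratic forms\<close>


lemma transpose_add: "transpose (M + N) = transpose M + transpose N"
  by (vector transpose_def)

lemma transpose_diff: "transpose (M - N) = transpose M - transpose N"
  by (vector transpose_def)

lemma transpose_uminus: "transpose (- M) = - transpose M"
  by (vector transpose_def)

lemma inner_transpose_transpose: "transpose M \<bullet> transpose N = (M :: real^'n^'m) \<bullet> N"
  unfolding inner_vec_def transpose_def by simp (rule sum.swap)

text \<open>\<open>inner\<close> on matrices is the Frobenius product tr(X^T Y). Moving factors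
  across it, here and in \<open>inner_matrix_mult_right\<close>, plays the part of cyclicity of the
  trace.\<close>

lemma inner_matrix_mult_left:
  fixes M :: "real^'n^'m"
  shows "X \<bullet> (M ** Y) = (transpose M ** X) \<bullet> Y"
proof -
  have "X \<bullet> (M ** Y) = (\<Sum>i\<in>UNIV. \<Sum>j\<in>UNIV. \<Sum>k\<in>UNIV. X$i$j * (M$i$k * Y$k$j))"
    by (simp add: inner_vec_def matrix_matrix_mult_def sum_distrib_left)
  also have "\<dots> = (\<Sum>i\<in>UNIV. \<Sum>k\<in>UNIV. \<Sum>j\<in>UNIV. X$i$j * (M$i$k * Y$k$j))"
    by (intro sum.cong sum.swap refl)
  also have "\<dots> = (\<Sum>k\<in>UNIV. \<Sum>i\<in>UNIV. \<Sum>j\<in>UNIV. X$i$j * (M$i$k * Y$k$j))"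
    by (rule sum.swap)
  also have "\<dots> = (\<Sum>k\<in>UNIV. \<Sum>j\<in>UNIV. \<Sum>i\<in>UNIV. X$i$j * (M$i$k * Y$k$j))"
    by (intro sum.cong sum.swap refl)
  also have "\<dots> = (transpose M ** X) \<bullet> Y"
    by (simp add: inner_vec_def matrix_matrix_mult_def sum_distrib_left transpose_def mult_ac)
  finally show ?thesis .
qed

lemma inner_matrix_mult_right:
  fixes M :: "real^'n^'m"
  shows "X \<bullet> (Y ** M) = (X ** transpose M) \<bullet> Y"
proof -
  have "X \<bullet> (Y ** M) = transpose X \<bullet> (transpose M ** transpose Y)"
    by (simp add: inner_transpose_transpose flip: matrix_transpose_mul)
  also have "\<dots> = transpose (X ** transpose M) \<bullet> transpose Y"
    by (simp add: inner_matrix_mult_left matrix_transpose_mul)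
  finally show ?thesis by (simp add: inner_transpose_transpose)
qed

lemma inner_matrix_vector_mult:
  fixes M :: "real^'n^'m"
  shows "x \<bullet> (M *v y) = (transpose M *v x) \<bullet> y"
  by (simp add: dot_lmul_matrix)

lemma inner_outer_square: "M \<bullet> outer_square x = x \<bullet> (M *v x)"
  by (simp add: inner_vec_def outer_square_def matrix_vector_mult_def sum_distrib_left mult_ac)

lemma bounded_bilinear_matrix_mult:
  "bounded_bilinear (\<lambda>(M::real^'n^'m) (N::real^'k^'n). M ** N)"
proof -
  have "bilinear (\<lambda>(M::real^'n^'m) (N::real^'k^'n). M ** N)"
    unfolding bilinear_def
    by (intro conjI allI linearI)
      (simp_all add: vec_eq_iff matrix_matrix_mult_def sum.distrib algebra_simps sum_distrib_left)
  then show ?thesis by (simp add: bilinear_conv_bounded_bilinear)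
qed

lemmas matrix_mult_has_derivative = bounded_bilinear.FDERIV[OF bounded_bilinear_matrix_mult]

lemma bounded_linear_transpose: "bounded_linear (transpose :: real^'n^'m \<Rightarrow> real^'m^'n)"
  by (intro linear_conv_bounded_linear[THEN iffD1] linearI) (simp_all add: transpose_add transpose_scalar)

interpretation matrix_mult: bounded_bilinear "(\<lambda>(M::real^'n^'m) (N::real^'k^'n). M ** N)"
  by (rule bounded_bilinear_matrix_mult)

lemma mat_norm_nonneg: "0 \<le> mat_norm M"
  unfolding mat_norm_def by (intro onorm_pos_le matrix_vector_mul_bounded_linear)

lemma norm_matrix_vector_mult: "norm (M *v x) \<le> mat_norm M * norm x"
  unfolding mat_norm_def by (rule onorm) (rule matrix_vector_mul_bounded_linear)

lemma mat_norm_leI: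
  assumes "\<And>x y. \<bar>x \<bullet> (M *v y)\<bar> \<le> c * (norm x * norm y)"
  shows "mat_norm M \<le> c"
  unfolding mat_norm_def
proof (rule onorm_le)
  fix y
  show "norm (M *v y) \<le> c * norm y"
  proof (cases "M *v y = 0")
    case True
    \<comment> \<open>Any pair of unit vectors shows that \<open>c\<close> is nonnegative.\<close>
    from assms[of "axis undefined 1" "axis undefined 1"] have "0 \<le> c * (1 * 1)"
      by (simp add: norm_axis_1)
    with True show ?thesis by simp
  next
    case False
    have "norm (M *v y) * norm (M *v y) \<le> (c * norm y) * norm (M *v y)"
      using assms[of "M *v y" y] by (simp add: dot_square_norm power2_eq_square mult_ac)
    with False show ?thesis by simp
  qed
qed

lemma mat_norm_leI_unit:
  assumes "\<And>x y. norm x = 1 \<Longrightarrow> norm y = 1 \<Longrightarrow> \<bar>x \<bullet> (M *v y)\<bar> \<le> c"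
  shows "mat_norm M \<le> c"
proof (rule mat_norm_leI)
  fix x y
  show "\<bar>x \<bullet> (M *v y)\<bar> \<le> c * (norm x * norm y)"
  proof (cases "x = 0 \<or> y = 0")
    case False
    have "\<bar>(x /\<^sub>R norm x) \<bullet> (M *v (y /\<^sub>R norm y))\<bar> \<le> c"
      by (rule assms) (use False in auto)
    then show ?thesis using False
      by (simp add: matrix_vector_mult_scaleR abs_mult field_simps)
  qed auto
qed

lemma inner_matrix_vector_le: "\<bar>x \<bullet> (M *v y)\<bar> \<le> mat_norm M * (norm x * norm y)"
proof -
  have "\<bar>x \<bullet> (M *v y)\<bar> \<le> norm x * norm (M *v y)" by (rule Cauchy_Schwarz_ineq2)
  also have "\<dots> \<le> norm x * (mat_norm M * norm y)"
    by (intro mult_left_mono norm_matrix_vector_mult norm_ge_zero)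
  finally show ?thesis by (simp add: mult_ac)
qed

lemma mat_norm_transpose_le: "mat_norm (transpose M) \<le> mat_norm M"
proof (rule mat_norm_leI)
  fix x y
  show "\<bar>x \<bullet> (transpose M *v y)\<bar> \<le> mat_norm M * (norm x * norm y)"
    using inner_matrix_vector_le[of y M x] inner_matrix_vector_mult[of y M x]
    by (simp only: inner_commute[of x] mult.commute)
qed

lemma mat_norm_transpose: "mat_norm (transpose M) = mat_norm M"
  using mat_norm_transpose_le[of M] mat_norm_transpose_le[of "transpose M"] by simp

text \<open>Column by column. \<open>norm\<close> of a matrix is the Frobenius norm; mixing it with
  the operator norm keeps the constant free of dimensions.\<close>

lemma norm_matrix_mult_left: "norm (M ** (X :: real^'k^'n)) \<le> mat_norm M * norm X"
proof -
  have col: "transpose (M ** X) $ j = M *v (transpose X $ j)" for j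
    by (simp add: vec_eq_iff transpose_def matrix_matrix_mult_def matrix_vector_mult_def)
  have "(norm (transpose (M ** X)))\<^sup>2 \<le> (mat_norm M * norm (transpose X))\<^sup>2"
    unfolding norm_vec_def[of "transpose (M ** X)"] norm_vec_def[of "transpose X"] power_mult_distrib
      L2_set_def col
    by (simp add: sum_nonneg sum_distrib_left flip: power_mult_distrib)
      (intro sum_mono power_mono norm_matrix_vector_mult norm_ge_zero)
  then have "norm (transpose (M ** X)) \<le> mat_norm M * norm (transpose X)"
    by (rule power2_le_imp_le) (simp add: mat_norm_nonneg)
  then show ?thesis by (simp add: norm_eq_sqrt_inner inner_transpose_transpose)
qed

lemma norm_matrix_mult_right: "norm ((X :: real^'n^'k) ** M) \<le> norm X * mat_norm M"
proof -
  have "norm (transpose (X ** M)) \<le> mat_norm (transpose M) * norm (transpose X)"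
    unfolding matrix_transpose_mul by (rule norm_matrix_mult_left)
  then show ?thesis
    by (simp add: norm_eq_sqrt_inner inner_transpose_transpose mat_norm_transpose mult.commute)
qed

text \<open>The bilinear form is the Frobenius product of \<open>M\<close> with the rank one matrix
  x y^T, whose Frobenius norm is \<open>norm x * norm y\<close>.\<close>

lemma mat_norm_le_norm: "mat_norm (M :: real^'n^'m) \<le> norm M"
proof (rule mat_norm_leI)
  fix x :: "real^'m" and y :: "real^'n"
  have row: "(\<chi> i j. x $ i * y $ j) $ i = x $ i *\<^sub>R y" for i
    by (simp add: vec_eq_iff)
  have "x \<bullet> (M *v y) = M \<bullet> (\<chi> i j. x $ i * y $ j)"
    by (simp add: inner_vec_def matrix_vector_mult_def sum_distrib_left mult_ac)
  also have "\<bar>\<dots>\<bar> \<le> norm M * norm (\<chi> i j. x $ i * y $ j)" by (rule Cauchy_Schwarz_ineq2)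
  also have "norm (\<chi> i j. x $ i * y $ j) = L2_set (\<lambda>i. norm (x $ i *\<^sub>R y)) UNIV"
    unfolding norm_vec_def[of "\<chi> i j. x $ i * y $ j"] row ..
  also have "\<dots> = norm x * norm y"
    by (simp add: norm_vec_def[of x] L2_set_left_distrib)
  finally show "\<bar>x \<bullet> (M *v y)\<bar> \<le> norm M * (norm x * norm y)" .
qed

section \<open>Semidefinite matrices and their semi-inner products\<close>

definition psd :: "real^'n^'n \<Rightarrow> bool"
  where "psd M \<longleftrightarrow> transpose M = M \<and> (\<forall>x. 0 \<le> x \<bullet> (M *v x))"

lemma psd_if_pos_def: "pos_def_mat M \<Longrightarrow> psd M"
  unfolding psd_def pos_def_mat_def by (metis inner_zero_left less_eq_real_def)

lemma discriminant_ineq: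
  fixes a b c :: real
  assumes "\<And>t. 0 \<le> a + 2 * t * b + t\<^sup>2 * c" "0 \<le> c"
  shows "b\<^sup>2 \<le> a * c"
proof (cases "c = 0")
  case True
  have "b = 0"
  proof (rule ccontr)
    assume "b \<noteq> 0"
    \<comment> \<open>With \<open>c = 0\<close> the expression is affine in t, and this t gives it
      the value -1.\<close>
    with assms(1)[of "-(a + 1) / (2 * b)"] True show False by (simp add: field_simps)
  qed
  with True show ?thesis by simp
next
  case False
  with assms(1)[of "- b / c"] assms(2) show ?thesis
    by (simp add: field_simps power2_eq_square)
qed

lemma psd_Cauchy_Schwarz:
  assumes "psd M"
  shows "(x \<bullet> (M *v y))\<^sup>2 \<le> (x \<bullet> (M *v x)) * (y \<bullet> (M *v y))"
proof (rule discriminant_ineq)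
  fix t
  have "y \<bullet> (M *v x) = x \<bullet> (M *v y)"
    using assms unfolding psd_def by (metis inner_commute inner_matrix_vector_mult)
  then have "x \<bullet> (M *v x) + 2 * t * (x \<bullet> (M *v y)) + t\<^sup>2 * (y \<bullet> (M *v y))
      = (x + t *\<^sub>R y) \<bullet> (M *v (x + t *\<^sub>R y))"
    by (simp add: algebra_simps inner_simps power2_eq_square)
  then show "0 \<le> x \<bullet> (M *v x) + 2 * t * (x \<bullet> (M *v y)) + t\<^sup>2 * (y \<bullet> (M *v y))"
    using assms unfolding psd_def by metis
qed (use assms in \<open>simp add: psd_def\<close>)

lemma psd_amgm:
  assumes "psd M"
  shows "2 * \<bar>x \<bullet> (M *v y)\<bar> \<le> x \<bullet> (M *v x) + y \<bullet> (M *v y)"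
proof -
  have sym: "y \<bullet> (M *v x) = x \<bullet> (M *v y)"
    using assms unfolding psd_def by (metis inner_commute inner_matrix_vector_mult)
  have "0 \<le> (x + y) \<bullet> (M *v (x + y))" "0 \<le> (x - y) \<bullet> (M *v (x - y))"
    using assms unfolding psd_def by blast+
  then show ?thesis using sym by (simp add: algebra_simps inner_simps)
qed

text \<open>Cauchy-Schwarz against each basis vector, summed, gives |M x|^2 <= tr(M) q with q = x^T
  M x. Combined with q <= |x| |M x|, one factor q cancels.\<close>

lemma psd_quadratic_le_trace:
  assumes "psd M"
  shows "x \<bullet> (M *v x) \<le> trace M * (norm x)\<^sup>2"
proof -
  define q where "q = x \<bullet> (M *v x)"
  have q: "q \<ge> 0" using assms by (simp add: q_def psd_def)
  have diag: "axis i 1 \<bullet> (M *v axis i 1) = M $ i $ i" for i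
    by (simp add: inner_axis' matrix_vector_mult_basis column_def)
  have tr: "trace M \<ge> 0" unfolding trace_def
    using assms by (intro sum_nonneg) (metis diag psd_def)
  have "(norm (M *v x))\<^sup>2 = (\<Sum>i\<in>UNIV. (axis i 1 \<bullet> (M *v x))\<^sup>2)"
    by (simp add: norm_vec_def L2_set_def sum_nonneg inner_axis')
  also have "\<dots> \<le> (\<Sum>i\<in>UNIV. M $ i $ i * q)"
    unfolding q_def using psd_Cauchy_Schwarz[OF assms] by (intro sum_mono) (metis diag)
  also have "\<dots> = trace M * q" by (simp add: trace_def sum_distrib_right)
  finally have "(norm (M *v x))\<^sup>2 \<le> trace M * q" .
  moreover have "q\<^sup>2 \<le> (norm x)\<^sup>2 * (norm (M *v x))\<^sup>2"
    unfolding q_def power_mult_distrib[symmetric]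
    using Cauchy_Schwarz_ineq2[of x "M *v x"] by (metis abs_ge_zero power2_abs power_mono)
  ultimately have "q * q \<le> (trace M * (norm x)\<^sup>2) * q"
    by (smt (verit, best) mult.assoc mult.commute mult_left_mono power2_eq_square zero_le_power2)
  then show ?thesis using q tr unfolding q_def
    by (cases "q = 0") (auto simp: q_def)
qed

lemma inner_psd_form:
  fixes V :: "real^'n^'k"
  shows "V \<bullet> (V ** M) = (\<Sum>i\<in>UNIV. (V $ i) \<bullet> (transpose M *v (V $ i)))"
proof -
  have "(V ** M) $ i = transpose M *v (V $ i)" for i
    by (simp add: vec_eq_iff matrix_matrix_mult_def matrix_vector_mult_def transpose_def mult.commute
        del: transpose_matrix_vector)
  then show ?thesis by (simp add: inner_vec_def[of V])
qed

text \<open>\<open>U \<bullet> (V ** X)\<close> is \<open>tr(U\<^sup>T V X)\<close>, a semi-inner product of \<open>U\<close> and \<open>V\<close>.\<close>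

lemma psd_matrix_Cauchy_Schwarz:
  fixes U V :: "real^'n^'k"
  assumes "psd X"
  shows "(U \<bullet> (V ** X))\<^sup>2 \<le> (U \<bullet> (U ** X)) * (V \<bullet> (V ** X))"
proof (rule discriminant_ineq)
  have X: "transpose X = X" and nn: "0 \<le> W \<bullet> (W ** X)" for W :: "real^'n^'k"
    using assms unfolding inner_psd_form by (auto intro!: sum_nonneg simp: psd_def simp del: transpose_matrix_vector)
  show "0 \<le> V \<bullet> (V ** X)" by (rule nn)
  fix t
  have "V \<bullet> (U ** X) = U \<bullet> (V ** X)"
    by (metis X inner_commute inner_matrix_mult_right)
  then have "U \<bullet> (U ** X) + 2 * t * (U \<bullet> (V ** X)) + t\<^sup>2 * (V \<bullet> (V ** X))
      = (U + t *\<^sub>R V) \<bullet> ((U + t *\<^sub>R V) ** X)"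
    by (simp add: algebra_simps inner_simps power2_eq_square matrix_mult.add_left matrix_mult.scaleR_left)
  then show "0 \<le> U \<bullet> (U ** X) + 2 * t * (U \<bullet> (V ** X)) + t\<^sup>2 * (V \<bullet> (V ** X))"
    using nn by metis
qed

lemma psd_inner_self_le:
  fixes U :: "real^'n^'k"
  assumes "psd X"
  shows "U \<bullet> (U ** X) \<le> trace X * (norm U)\<^sup>2"
proof -
  have "U \<bullet> (U ** X) = (\<Sum>i\<in>UNIV. (U $ i) \<bullet> (X *v (U $ i)))"
    using assms unfolding inner_psd_form psd_def by metis
  also have "\<dots> \<le> (\<Sum>i\<in>UNIV. trace X * (norm (U $ i))\<^sup>2)"
    by (intro sum_mono psd_quadratic_le_trace assms)
  also have "\<dots> = trace X * (norm U)\<^sup>2"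
    by (simp add: norm_vec_def[of U] L2_set_def sum_nonneg sum_distrib_left)
  finally show ?thesis .
qed

lemma psd_trace_nonneg: "psd X \<Longrightarrow> 0 \<le> trace X"
  using psd_quadratic_le_trace[of X "axis undefined 1"] unfolding psd_def
  by (metis mult.right_neutral norm_axis_1 one_power2 order_trans)

lemma psd_inner_le:
  fixes U V :: "real^'n^'k"
  assumes "psd X"
  shows "\<bar>U \<bullet> (V ** X)\<bar> \<le> trace X * (norm U * norm V)"
proof -
  have V0: "0 \<le> V \<bullet> (V ** X)"
    using assms unfolding inner_psd_form psd_def by (intro sum_nonneg) metis
  have "(U \<bullet> (V ** X))\<^sup>2 \<le> (U \<bullet> (U ** X)) * (V \<bullet> (V ** X))"
    by (rule psd_matrix_Cauchy_Schwarz[OF assms])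
  also have "\<dots> \<le> (trace X * (norm U)\<^sup>2) * (trace X * (norm V)\<^sup>2)"
    using V0 psd_trace_nonneg[OF assms] by (intro mult_mono psd_inner_self_le assms) auto
  also have "\<dots> = (trace X * (norm U * norm V))\<^sup>2"
    by (simp add: power2_eq_square mult_ac)
  finally show ?thesis
    using psd_trace_nonneg[OF assms] by (simp add: abs_le_square_iff[symmetric])
qed

text \<open>Meant for V = A_K and X the state covariance, where \<open>V \<bullet> (V ** X)\<close>
  is controlled although no bound on the Frobenius norm of V is at hand.\<close>

lemma inner_psd_le:
  fixes U :: "real^'n^'k"
  assumes "psd X" "V \<bullet> (V ** X) \<le> trace X"
  shows "\<bar>U \<bullet> (V ** X)\<bar> \<le> trace X * norm U"
proof -
  have U0: "0 \<le> U \<bullet> (U ** X)"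
    using assms unfolding inner_psd_form psd_def by (intro sum_nonneg) metis
  have "(U \<bullet> (V ** X))\<^sup>2 \<le> (U \<bullet> (U ** X)) * (V \<bullet> (V ** X))"
    by (rule psd_matrix_Cauchy_Schwarz[OF assms(1)])
  also have "\<dots> \<le> (U \<bullet> (U ** X)) * trace X"
    by (intro mult_left_mono U0 assms)
  also have "\<dots> \<le> (trace X * (norm U)\<^sup>2) * trace X"
    using psd_trace_nonneg[OF assms(1)] by (intro mult_right_mono psd_inner_self_le assms) auto
  also have "\<dots> = (trace X * norm U)\<^sup>2"
    by (simp add: power2_eq_square mult_ac)
  finally show ?thesis
    using psd_trace_nonneg[OF assms(1)] by (simp add: abs_le_square_iff[symmetric])
qed

lemma mat_norm_le_if_quadratic:
  fixes M :: "real^'n^'n"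
  assumes "transpose M = M" "\<And>x. \<bar>x \<bullet> (M *v x)\<bar> \<le> c * (norm x)\<^sup>2"
  shows "mat_norm M \<le> c"
proof (rule mat_norm_leI_unit)
  fix x y :: "real^'n"
  assume unit: "norm x = 1" "norm y = 1"
  have "y \<bullet> (M *v x) = x \<bullet> (M *v y)"
    using assms(1) by (metis inner_commute inner_matrix_vector_mult)
  \<comment> \<open>Polarization; the parallelogram law then keeps the constant
    \<open>c\<close>.\<close>
  then have "4 * (x \<bullet> (M *v y)) = (x + y) \<bullet> (M *v (x + y)) - (x - y) \<bullet> (M *v (x - y))"
    by (simp add: algebra_simps inner_simps)
  then have "4 * \<bar>x \<bullet> (M *v y)\<bar> \<le> c * (norm (x + y))\<^sup>2 + c * (norm (x - y))\<^sup>2"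
    using assms(2)[of "x + y"] assms(2)[of "x - y"] by linarith
  also have "\<dots> = 2 * c * ((norm x)\<^sup>2 + (norm y)\<^sup>2)"
    by (simp add: power2_norm_eq_inner algebra_simps inner_simps)
  finally show "\<bar>x \<bullet> (M *v y)\<bar> \<le> c" using unit by simp
qed

section \<open>The least singular value of a positive definite matrix\<close>

text \<open>\<open>sigma_min\<close> is a \<open>Min\<close>. Squaring maps the singular values,
  injectively as they are nonnegative, into the finite spectrum of M^T M.\<close>

lemma finite_singular_values: "finite (singular_values M)"
proof (rule finite_imageD)
  let ?f = "\<lambda>s::real. complex_of_real (s\<^sup>2)"
  have "?f ` singular_values M \<subseteq> complex_eigenvalues (transpose M ** M)"
  proof clarify
    fix s assume "s \<in> singular_values M"
    then obtain v where v: "v \<noteq> 0" "(transpose M ** M) *v v = s\<^sup>2 *s v"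
      by (auto simp: singular_values_def)
    let ?v = "\<chi> i. complex_of_real (v $ i)"
    have "map_matrix complex_of_real (transpose M ** M) *v ?v = ?f s *s ?v"
      using v(2) by (simp add: vec_eq_iff matrix_vector_mult_def flip: of_real_mult of_real_sum of_real_power)
    moreover have "?v \<noteq> 0" using v(1) by (simp add: vec_eq_iff)
    ultimately show "?f s \<in> complex_eigenvalues (transpose M ** M)"
      by (auto simp: complex_eigenvalues_def)
  qed
  then show "finite (?f ` singular_values M)"
    using finite_complex_eigenvalues finite_subset by blast
  show "inj_on ?f (singular_values M)"
    by (rule inj_onI) (simp add: singular_values_def del: of_real_power)
qed

text \<open>Let v minimize the form on the unit sphere, with value l. Then M - l I is semidefinite
  and its form vanishes at v, which Cauchy-Schwarz turns into (M - l I) v = 0.\<close>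

lemma pos_def_min_eigenvector:
  fixes M :: "real^'n^'n"
  assumes "pos_def_mat M"
  obtains l v where "l > 0" "v \<noteq> 0" "M *v v = l *s v" "\<And>x. l * (norm x)\<^sup>2 \<le> x \<bullet> (M *v x)"
proof -
  let ?S = "sphere (0 :: real^'n) 1"
  have "compact ?S" by simp
  moreover have "axis undefined 1 \<in> ?S" by simp
  then have "?S \<noteq> {}" by blast
  moreover have "continuous_on ?S (\<lambda>x. x \<bullet> (M *v x))"
    by (intro continuous_intros linear_continuous_on matrix_vector_mul_bounded_linear)
  ultimately obtain v where v: "v \<in> ?S" "\<And>x. x \<in> ?S \<Longrightarrow> v \<bullet> (M *v v) \<le> x \<bullet> (M *v x)"
    using continuous_attains_inf[of ?S "\<lambda>x. x \<bullet> (M *v x)"] by blast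
  define l where "l = v \<bullet> (M *v v)"
  have nv: "norm v = 1" using v by simp
  then have "v \<noteq> 0" by auto
  then have "l > 0" using assms by (simp add: l_def pos_def_mat_def)
  have ray: "l * (norm x)\<^sup>2 \<le> x \<bullet> (M *v x)" for x
  proof (cases "x = 0")
    case False
    have "l \<le> (x /\<^sub>R norm x) \<bullet> (M *v (x /\<^sub>R norm x))"
      unfolding l_def by (rule v(2)) (use False in simp)
    then show ?thesis using False
      by (simp add: matrix_vector_mult_scaleR field_simps power2_eq_square)
  qed simp
  define N where "N = M - l *\<^sub>R mat 1"
  have N: "N *v x = M *v x - l *\<^sub>R x" for x
    by (simp add: N_def matrix_vector_mult_diff_rdistrib flip: scaleR_matrix_vector_assoc)
  have "psd N" unfolding psd_def
  proof
    show "transpose N = N"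
      using assms by (simp add: N_def pos_def_mat_def transpose_diff transpose_scalar)
    show "\<forall>x. 0 \<le> x \<bullet> (N *v x)"
      using ray by (simp add: N inner_diff_right power2_norm_eq_inner)
  qed
  moreover have "v \<bullet> (N *v v) = 0"
    using nv by (simp add: N l_def inner_diff_right dot_square_norm)
  ultimately have "((N *v v) \<bullet> (N *v v))\<^sup>2 \<le> 0"
    using psd_Cauchy_Schwarz[of N "N *v v" v] by simp
  then have "N *v v = 0" by simp
  then have "M *v v = l *s v" by (simp add: N scalar_mult_eq_scaleR)
  with that \<open>l > 0\<close> \<open>v \<noteq> 0\<close> ray show ?thesis by blast
qed

text \<open>The eigenvalue l just found is a singular value, so \<open>sigma_min M <= l\<close> and
  its lower bound carries over. Positivity holds because \<open>sigma_min M\<close> is attained and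
  \<open>M\<close> is injective.\<close>

lemma sigma_min_pos_def:
  fixes M :: "real^'n^'n"
  assumes "pos_def_mat M"
  shows "sigma_min M > 0" and "sigma_min M * (norm x)\<^sup>2 \<le> x \<bullet> (M *v x)"
proof -
  obtain l v where l: "l > 0" "v \<noteq> 0" "M *v v = l *s v" "\<And>x. l * (norm x)\<^sup>2 \<le> x \<bullet> (M *v x)"
    using pos_def_min_eigenvector[OF assms] by blast
  have sym: "transpose M = M" using assms by (simp add: pos_def_mat_def)
  have MM: "(transpose M ** M) *v y = M *v (M *v y)" for y
    by (simp add: sym matrix_vector_mul_assoc)
  have mem: "l \<in> singular_values M"
    unfolding singular_values_def mem_Collect_eq MM
    using l by (intro conjI exI[of _ v]) (simp_all add: vector_scalar_commute power2_eq_square vector_smult_assoc)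
  then have le: "sigma_min M \<le> l"
    unfolding sigma_min_def by (intro Min_le finite_singular_values)
  have "sigma_min M \<in> singular_values M"
    unfolding sigma_min_def using mem finite_singular_values by (intro Min_in) auto
  then obtain w where w: "sigma_min M \<ge> 0" "w \<noteq> 0" "M *v (M *v w) = (sigma_min M)\<^sup>2 *s w"
    unfolding singular_values_def mem_Collect_eq MM by blast
  have inj: "M *v y = 0 \<Longrightarrow> y = 0" for y
    using assms unfolding pos_def_mat_def by (metis inner_zero_right less_irrefl)
  have "sigma_min M \<noteq> 0" using w inj[of w] inj[of "M *v w"] by auto
  then show "sigma_min M > 0" using w(1) by simp
  show "sigma_min M * (norm x)\<^sup>2 \<le> x \<bullet> (M *v x)"
    using mult_right_mono[OF le, of "(norm x)\<^sup>2"] l(4)[of x] by simp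
qed

section \<open>The Lyapunov equation\<close>


lemma inner_iterate_transpose:
  fixes A :: "real^'n^'n"
  shows "(((*v) (transpose A)) ^^ t) x \<bullet> y = x \<bullet> (((*v) A) ^^ t) y"
proof (induction t arbitrary: y)
  case (Suc t)
  have "(((*v) (transpose A)) ^^ Suc t) x \<bullet> y = (((*v) (transpose A)) ^^ t) x \<bullet> (A *v y)"
    by (simp add: inner_matrix_vector_mult del: transpose_matrix_vector)
  then show ?case by (simp only: Suc funpow_Suc_right o_apply)
qed simp

lemma stable_transpose:
  assumes "stable A"
  shows "stable (transpose A)"
  unfolding stable_def
proof (intro allI vec_tendstoI)
  fix x i
  have "(((*v) (transpose A)) ^^ t) x $ i = x \<bullet> (((*v) A) ^^ t) (axis i 1)" for t
    by (simp add: inner_axis del: transpose_matrix_vector flip: inner_iterate_transpose)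
  moreover have "(\<lambda>t. x \<bullet> (((*v) A) ^^ t) (axis i 1)) \<longlonglongrightarrow> x \<bullet> 0"
    using assms unfolding stable_def by (intro tendsto_inner tendsto_const) auto
  ultimately show "(\<lambda>t. (((*v) (transpose A)) ^^ t) x $ i) \<longlonglongrightarrow> 0 $ i" by simp
qed

text \<open>The solution is unique for stable \<open>A\<close>; otherwise the value is arbitrary.\<close>

definition lyap :: "real^'n^'n \<Rightarrow> real^'n^'n \<Rightarrow> real^'n^'n"
  where "lyap A S = (THE Z. Z - transpose A ** Z ** A = S)"

lemma inner_congruence:
  fixes A :: "real^'n^'m"
  shows "x \<bullet> ((transpose A ** Z ** A) *v y) = (A *v x) \<bullet> (Z *v (A *v y))"
proof -
  have "x \<bullet> ((transpose A ** Z ** A) *v y) = x \<bullet> (transpose A *v (Z *v (A *v y)))"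
    by (simp only: matrix_vector_mul_assoc matrix_mul_assoc)
  then show ?thesis by (simp only: inner_matrix_vector_mult[of x "transpose A"] transpose_transpose)
qed

lemma lyapunov_step:
  fixes A :: "real^'n^'n"
  assumes "Z - transpose A ** Z ** A = S"
  shows "x \<bullet> (Z *v y) = x \<bullet> (S *v y) + (A *v x) \<bullet> (Z *v (A *v y))"
proof -
  have "Z = S + transpose A ** Z ** A" using assms by (simp add: algebra_simps)
  then have "x \<bullet> (Z *v y) = x \<bullet> ((S + transpose A ** Z ** A) *v y)" by (rule arg_cong)
  also have "\<dots> = x \<bullet> (S *v y) + x \<bullet> ((transpose A ** Z ** A) *v y)"
    by (simp only: matrix_vector_mult_add_rdistrib inner_add_right)
  also have "x \<bullet> ((transpose A ** Z ** A) *v y) = (A *v x) \<bullet> (Z *v (A *v y))"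
    by (rule inner_congruence)
  finally show ?thesis .
qed

lemma lyapunov_iterate:
  fixes A :: "real^'n^'n"
  assumes "Z - transpose A ** Z ** A = S"
  shows "x \<bullet> (Z *v y) = (\<Sum>s<t. (((*v) A) ^^ s) x \<bullet> (S *v (((*v) A) ^^ s) y))
    + (((*v) A) ^^ t) x \<bullet> (Z *v (((*v) A) ^^ t) y)"
proof (induction t)
  case (Suc t)
  then show ?case
    using lyapunov_step[OF assms, of "(((*v) A) ^^ t) x" "(((*v) A) ^^ t) y"] by simp
qed simp

lemma stable_quadratic_tendsto:
  assumes "stable A"
  shows "(\<lambda>t. (((*v) A) ^^ t) x \<bullet> (Z *v (((*v) A) ^^ t) y)) \<longlonglongrightarrow> 0"
proof -
  have "(\<lambda>t. (((*v) A) ^^ t) x \<bullet> (Z *v (((*v) A) ^^ t) y)) \<longlonglongrightarrow> 0 \<bullet> (Z *v 0)"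
    using assms unfolding stable_def
    by (intro tendsto_inner bounded_linear.tendsto[OF matrix_vector_mul_bounded_linear]) auto
  then show ?thesis by simp
qed

text \<open>Convergence is read off from a solution Z: the partial sums telescope and the remainder
  vanishes by stability. The bilinear form in x and y determines Z itself.\<close>

lemma lyapunov_sums:
  assumes "stable A" "Z - transpose A ** Z ** A = S"
  shows "(\<lambda>t. (((*v) A) ^^ t) x \<bullet> (S *v (((*v) A) ^^ t) y)) sums (x \<bullet> (Z *v y))"
proof -
  have "(\<Sum>s<t. (((*v) A) ^^ s) x \<bullet> (S *v (((*v) A) ^^ s) y))
      = x \<bullet> (Z *v y) - (((*v) A) ^^ t) x \<bullet> (Z *v (((*v) A) ^^ t) y)" for t
    using lyapunov_iterate[OF assms(2), of x y t] by simp
  moreover have "(\<lambda>t. x \<bullet> (Z *v y) - (((*v) A) ^^ t) x \<bullet> (Z *v (((*v) A) ^^ t) y))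
      \<longlonglongrightarrow> x \<bullet> (Z *v y) - 0"
    by (intro tendsto_diff tendsto_const stable_quadratic_tendsto assms)
  ultimately show ?thesis by (simp add: sums_def)
qed

lemma lyapunov_eq_0:
  assumes "stable A" "Z - transpose A ** Z ** A = 0"
  shows "Z = 0"
proof -
  have "x \<bullet> (Z *v y) = 0" for x y
    using sums_unique2[OF lyapunov_sums[OF assms, of x y] ] by (simp add: sums_zero)
  then have "Z *v y = 0 *v y" for y
    by (metis inner_eq_zero_iff matrix_vector_mult_0)
  then show ?thesis by (simp add: matrix_eq)
qed

lemma linear_lyapunov: "linear (\<lambda>Z :: real^'n^'n. Z - transpose A ** Z ** A)"
  by (intro linearI) (simp_all add: matrix_mult.add_left matrix_mult.add_right matrix_mult.scaleR_left matrix_mult.scaleR_right algebra_simps)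

lemma lyapunov_unique:
  assumes "stable A" "Z - transpose A ** Z ** A = S" "Y - transpose A ** Y ** A = S"
  shows "Z = Y"
proof -
  have "(Z - Y) - transpose A ** (Z - Y) ** A
      = (Z - transpose A ** Z ** A) - (Y - transpose A ** Y ** A)"
    by (rule linear_diff[OF linear_lyapunov])
  then have "(Z - Y) - transpose A ** (Z - Y) ** A = 0"
    by (simp only: assms diff_self)
  then have "Z - Y = 0" by (rule lyapunov_eq_0[OF assms(1)])
  then show ?thesis by simp
qed

text \<open>Existence follows from uniqueness: an injective linear operator on a finite-dimensional
  space is surjective.\<close>

lemma lyap_eq:
  assumes "stable A"
  shows "lyap A S - transpose A ** lyap A S ** A = S"
proof -
  have "inj (\<lambda>Z. Z - transpose A ** Z ** A)"
    using lyapunov_unique[OF assms] by (intro injI) blast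
  then have "surj (\<lambda>Z. Z - transpose A ** Z ** A)"
    by (rule linear_injective_imp_surjective[OF linear_lyapunov]) (rule refl)
  then obtain Z where "S = Z - transpose A ** Z ** A" by (rule surjE)
  then have "\<exists>!Z. Z - transpose A ** Z ** A = S"
    using lyapunov_unique[OF assms] by blast
  then show ?thesis unfolding lyap_def by (rule theI')
qed

lemma lyap_unique: "stable A \<Longrightarrow> Z - transpose A ** Z ** A = S \<Longrightarrow> Z = lyap A S"
  using lyapunov_unique lyap_eq by blast

lemma lyap_transpose:
  assumes "stable A"
  shows "transpose (lyap A S) = lyap A (transpose S)"
proof (rule lyap_unique[OF assms])
  have "transpose (lyap A S - transpose A ** lyap A S ** A) = transpose S"
    by (simp add: lyap_eq[OF assms])
  then show "transpose (lyap A S) - transpose A ** transpose (lyap A S) ** A = transpose S"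
    by (simp add: transpose_diff matrix_transpose_mul matrix_mul_assoc)
qed

lemma lyap_psd:
  assumes "stable A" "psd S"
  shows "psd (lyap A S)"
  unfolding psd_def
proof (intro conjI allI)
  show "transpose (lyap A S) = lyap A S"
    using assms lyap_transpose by (metis psd_def)
  fix x
  show "0 \<le> x \<bullet> (lyap A S *v x)"
    using sums_le[OF _ sums_zero lyapunov_sums[OF assms(1) lyap_eq[OF assms(1)]]] assms(2)
    unfolding psd_def by blast
qed

lemma lyap_add: "stable A \<Longrightarrow> lyap A (S + T) = lyap A S + lyap A T"
  by (rule lyap_unique[symmetric]) (simp_all add: linear_add[OF linear_lyapunov] lyap_eq)

lemma lyap_diff: "stable A \<Longrightarrow> lyap A (S - T) = lyap A S - lyap A T"
  by (rule lyap_unique[symmetric]) (simp_all add: linear_diff[OF linear_lyapunov] lyap_eq)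

lemma lyap_scaleR: "stable A \<Longrightarrow> lyap A (c *\<^sub>R S) = c *\<^sub>R lyap A S"
  by (rule lyap_unique[symmetric]) (simp_all add: linear_cmul[OF linear_lyapunov] lyap_eq)

text \<open>The maps Z - A^T Z A and X - A X A^T are adjoint for the Frobenius product, hence so are
  their inverses.\<close>

lemma lyap_duality:
  assumes "stable A"
  shows "lyap A S \<bullet> Y = S \<bullet> lyap (transpose A) Y"
proof -
  let ?Z = "lyap A S" and ?X = "lyap (transpose A) Y"
  have Y: "?X - A ** ?X ** transpose A = Y"
    using lyap_eq[OF stable_transpose[OF assms], of Y] by simp
  have "?Z \<bullet> (A ** ?X ** transpose A) = (transpose A ** ?Z ** A) \<bullet> ?X"
    by (simp only: inner_matrix_mult_right[of ?Z "A ** ?X"] transpose_transpose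
        inner_matrix_mult_left[of "?Z ** A" A] matrix_mul_assoc)
  then have "?Z \<bullet> (?X - A ** ?X ** transpose A) = (?Z - transpose A ** ?Z ** A) \<bullet> ?X"
    by (simp add: inner_diff_left inner_diff_right)
  then show ?thesis by (simp add: Y lyap_eq[OF assms])
qed

section \<open>Dependence of Lyapunov solutions on parameters\<close>

lemma solution_has_derivative:
  fixes T :: "'a::real_normed_vector \<Rightarrow> 'b::euclidean_space \<Rightarrow> 'b"
  assumes lin: "\<And>y. linear (T y)"
    and inj: "\<And>z. T x z = 0 \<Longrightarrow> z = 0"
    and sol: "\<forall>\<^sub>F y in nhds x. T y (P y) = S y"
    and cont: "\<And>e. e > 0 \<Longrightarrow> \<forall>\<^sub>F y in nhds x. \<forall>z. norm (T y z - T x z) \<le> e * norm z"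
    and W: "((\<lambda>y. S y - T y (P x)) has_derivative W') (at x)"
    and P': "\<And>h. T x (P' h) = W' h"
  shows "(P has_derivative P') (at x)"
proof -
  define W where "W y = S y - T y (P x)" for y
  have W0: "W x = 0" using eventually_nhds_x_imp_x[OF sol] by (simp add: W_def)
  have "inj (T x)" using inj lin by (simp add: linear_injective_0)
  then obtain c where c: "c > 0" "\<And>z. c * norm z \<le> norm (T x z)"
    using linear_inj_bounded_below_pos[OF lin] by blast
  interpret W': bounded_linear W' using W by (rule has_derivative_bounded_linear)
  obtain k where k: "k > 0" "\<And>h. norm (W' h) \<le> norm h * k" using W'.pos_bounded by blast
  have "bounded_linear P'"
  proof (rule bounded_linear_intro[where K = "k / c"])
    show "P' (a + b) = P' a + P' b" for a b
      using inj[of "P' (a + b) - (P' a + P' b)"]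
      by (simp add: linear_diff[OF lin] linear_add[OF lin] P' W'.add)
    show "P' (r *\<^sub>R a) = r *\<^sub>R P' a" for r a
      using inj[of "P' (r *\<^sub>R a) - r *\<^sub>R P' a"]
      by (simp add: linear_diff[OF lin] linear_cmul[OF lin] P' W'.scaleR)
    show "norm (P' h) \<le> norm h * (k / c)" for h
      using c(2)[of "P' h"] k(2)[of h] \<open>c > 0\<close> by (simp add: P' field_simps)
  qed
  moreover have "\<exists>d>0. \<forall>y. norm (y - x) < d \<longrightarrow> norm (P y - P x - P' (y - x)) \<le> e * norm (y - x)"
    if "e > 0" for e
  proof -
    define e1 where "e1 = c * e / 2"
    \<comment> \<open>The entry \<open>c / 2\<close> lets \<open>e2 * norm D\<close> be absorbed
      into \<open>c * norm D\<close>; the other entry times the Lipschitz constant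
      \<open>2 * (k + e1) / c\<close> is exactly \<open>c * e / 2\<close>.\<close>
    define e2 where "e2 = min (c / 2) (c * e / 2 * (c / (2 * (k + e1))))"
    have e1: "e1 > 0" using c \<open>e > 0\<close> by (simp add: e1_def)
    have e2: "e2 > 0" using c k e1 \<open>e > 0\<close> by (simp add: e2_def)
    obtain d where "d > 0" "\<forall>y. norm (y - x) < d \<longrightarrow>
        norm (W y - W x - W' (y - x)) \<le> e1 * norm (y - x)"
      using W e1 unfolding has_derivative_at_alt W_def by blast
    then have 1: "\<forall>\<^sub>F y in nhds x. norm (W y - W' (y - x)) \<le> e1 * norm (y - x)"
      unfolding eventually_nhds_metric dist_norm W0 by auto
    have "\<forall>\<^sub>F y in nhds x. norm (P y - P x - P' (y - x)) \<le> e * norm (y - x)"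
      using 1 sol cont[OF e2]
    proof eventually_elim
      case (elim y)
      define D where "D = P y - P x"
      have TD: "T y D = W y" using elim(2) by (simp add: D_def W_def linear_diff[OF lin])
      have dT: "norm (T y D - T x D) \<le> e2 * norm D" using elim(3) by blast
      have Wy: "norm (W y) \<le> (k + e1) * norm (y - x)"
        using norm_triangle_ineq2[of "W y" "W' (y - x)"] elim(1) k(2)[of "y - x"]
        by (simp add: algebra_simps)
      have "c * norm D \<le> norm (W y) + e2 * norm D"
        using c(2)[of D] norm_triangle_ineq4[of "W y" "T y D - T x D"] dT by (simp add: TD)
      also have "e2 * norm D \<le> c / 2 * norm D"
          by (intro mult_right_mono) (simp_all only: e2_def min.cobounded1 norm_ge_zero)
      finally have "c / 2 * norm D \<le> (k + e1) * norm (y - x)" using Wy by simp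
      then have D: "norm D \<le> 2 * (k + e1) / c * norm (y - x)" using c by (simp add: field_simps)
      have "e2 * norm D \<le> (c * e / 2 * (c / (2 * (k + e1)))) * (2 * (k + e1) / c * norm (y - x))"
        using D e2 c k e1 \<open>e > 0\<close> by (intro mult_mono) (simp_all add: e2_def)
      also have "\<dots> = c * e / 2 * norm (y - x)" using c(1) add_pos_pos[OF k(1) e1]
          by (simp add: divide_simps)
      finally have e2D: "e2 * norm D \<le> c * e / 2 * norm (y - x)" .
      \<comment> \<open>The change of operator acts on D, already known to be of first order, so
        both summands are small against \<open>norm (y - x)\<close>.\<close>
      have "T x (D - P' (y - x)) = (W y - W' (y - x)) - (T y D - T x D)"
        by (simp add: linear_diff[OF lin] P' TD)
      then have "norm (T x (D - P' (y - x))) \<le> c * e / 2 * norm (y - x) + c * e / 2 * norm (y - x)"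
        using norm_triangle_ineq4[of "W y - W' (y - x)" "T y D - T x D"] elim(1) dT e2D
        by (simp add: e1_def)
      then have "c * norm (D - P' (y - x)) \<le> c * (e * norm (y - x))"
        using c(2)[of "D - P' (y - x)"] by (simp add: algebra_simps)
      then show ?case using c by (simp add: D_def)
    qed
    then show ?thesis unfolding eventually_nhds_metric dist_norm by blast
  qed
  ultimately show ?thesis unfolding has_derivative_at_alt by blast
qed

lemma norm_matrix_mult_le: "norm (M ** N) \<le> norm (M :: real^'n^'m) * norm (N :: real^'k^'n)"
  using norm_matrix_mult_left[of M N] mat_norm_le_norm[of M] by (meson mult_right_mono norm_ge_zero order_trans)

lemma norm_transpose: "norm (transpose M) = norm (M :: real^'n^'m)"
  by (simp add: norm_eq_sqrt_inner inner_transpose_transpose)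

lemma norm_congruence_diff_le:
  fixes A A' :: "real^'n^'n"
  shows "norm (transpose A ** Z ** A - transpose A' ** Z ** A')
    \<le> (norm A + norm A') * norm (A - A') * norm Z"
proof -
  have "transpose A ** Z ** A - transpose A' ** Z ** A'
      = transpose A ** Z ** (A - A') + transpose (A - A') ** Z ** A'"
    by (simp add: matrix_mult.diff_left matrix_mult.diff_right transpose_diff)
  also have "norm \<dots> \<le> norm (transpose A) * norm Z * norm (A - A')
      + norm (transpose (A - A')) * norm Z * norm A'"
    by (intro norm_triangle_mono order_trans[OF norm_matrix_mult_le] mult_right_mono norm_ge_zero norm_matrix_mult_le)
  finally show ?thesis by (simp add: norm_transpose algebra_simps)
qed

text \<open>For one fixed Z this keeps a Lyapunov function decreasing nearby; uniformly in Z it is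
  the continuity hypothesis of \<open>solution_has_derivative\<close>.\<close>

lemma eventually_congruence_diff_le:
  fixes A :: "'a::t2_space \<Rightarrow> real^'n^'n"
  assumes "isCont A x" "e > 0"
  shows "\<forall>\<^sub>F y in nhds x. \<forall>Z. norm (transpose (A x) ** Z ** A x - transpose (A y) ** Z ** A y)
    \<le> e * norm Z"
proof -
  have "((\<lambda>y. (norm (A x) + norm (A y)) * norm (A x - A y)) \<longlongrightarrow>
      (norm (A x) + norm (A x)) * norm (A x - A x)) (nhds x)"
    using assms(1) unfolding isCont_def tendsto_at_iff_tendsto_nhds by (intro tendsto_intros)
  then have "\<forall>\<^sub>F y in nhds x. (norm (A x) + norm (A y)) * norm (A x - A y) < e"
    by (rule order_tendstoD) (use assms in simp)
  then show ?thesis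
  proof eventually_elim
    case (elim y)
    then show ?case
      using norm_congruence_diff_le[of "A x" _ "A y"]
      by (meson less_eq_real_def mult_right_mono norm_ge_zero order_trans)
  qed
qed

text \<open>The solution Z with source \<open>mat 1\<close> drops by |v|^2 along \<open>A x\<close>.
  Near x the congruence term changes by less than |v|^2, so the same Z still drops along
  \<open>A y\<close>.\<close>

lemma eventually_spectral_radius_less_1:
  fixes A :: "'a::t2_space \<Rightarrow> real^'n^'n"
  assumes "isCont A x" "stable (A x)"
  shows "\<forall>\<^sub>F y in nhds x. spectral_radius (A y) < 1"
proof -
  define Z where "Z = lyap (A x) (mat 1)"
  have Z: "Z - transpose (A x) ** Z ** A x = mat 1"
    unfolding Z_def by (rule lyap_eq[OF assms(2)])
  have psd: "psd Z" unfolding Z_def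
    by (rule lyap_psd[OF assms(2)]) (simp add: psd_def)
  \<comment> \<open>This tolerance times \<open>norm Z\<close> stays below 1, the size of the
    source.\<close>
  have "1 / (2 * (norm Z + 1)) > 0" by (simp add: add_nonneg_pos)
  from eventually_congruence_diff_le[OF assms(1) this] show ?thesis
  proof eventually_elim
    case (elim y)
    let ?N = "transpose (A x) ** Z ** A x - transpose (A y) ** Z ** A y"
    have "norm ?N \<le> 1 / (2 * (norm Z + 1)) * norm Z" using elim by blast
    also have "\<dots> < 1"
    proof -
      have "0 < 2 * (norm Z + 1)" "norm Z < 2 * (norm Z + 1)"
        using norm_ge_zero[of Z] by (auto intro: add_nonneg_pos)
      then show ?thesis by (metis divide_less_eq_1_pos mult_1 times_divide_eq_left)
    qed
    finally have N: "norm ?N < 1" .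
    show ?case
    proof (rule spectral_radius_less_1_lyapunov[of Z])
      show "0 \<le> v \<bullet> (Z *v v)" for v using psd by (simp add: psd_def)
      fix v :: "real^'n" assume "v \<noteq> 0"
      have "v \<bullet> (?N *v v) = (A x *v v) \<bullet> (Z *v (A x *v v)) - (A y *v v) \<bullet> (Z *v (A y *v v))"
        by (simp only: matrix_vector_mult_diff_rdistrib inner_diff_right inner_congruence)
      moreover have "\<bar>v \<bullet> (?N *v v)\<bar> \<le> norm ?N * (norm v * norm v)"
        using inner_matrix_vector_le[of v ?N v] mat_norm_le_norm[of ?N]
        by (meson mult_nonneg_nonneg mult_right_mono norm_ge_zero order_trans)
      moreover have "norm ?N * (norm v * norm v) < 1 * (norm v * norm v)"
        using N \<open>v \<noteq> 0\<close> by (intro mult_strict_right_mono) auto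
      ultimately show "(A y *v v) \<bullet> (Z *v (A y *v v)) < v \<bullet> (Z *v v)"
        using lyapunov_step[OF Z, of v v] by (simp add: dot_square_norm power2_eq_square)
    qed
  qed
qed

text \<open>Implicit differentiation of Z - A^T Z A = S leaves a Lyapunov equation with the same A,
  the terms containing A' moving into the source.\<close>

lemma lyap_has_derivative:
  fixes A S :: "'a::real_normed_vector \<Rightarrow> real^'n^'n"
  assumes A: "(A has_derivative A') (at x)" and S: "(S has_derivative S') (at x)"
    and "stable (A x)"
  defines "Z \<equiv> lyap (A x) (S x)"
  shows "((\<lambda>y. lyap (A y) (S y)) has_derivative
    (\<lambda>h. lyap (A x) (S' h + (transpose (A' h) ** Z ** A x + transpose (A x) ** Z ** A' h)))) (at x)"
proof (rule solution_has_derivative[where T = "\<lambda>y Z. Z - transpose (A y) ** Z ** A y"])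
  have cont: "isCont A x" using A has_derivative_continuous continuous_at by blast
  show "linear (\<lambda>Z. Z - transpose (A y) ** Z ** A y)" for y by (rule linear_lyapunov)
  show "Y - transpose (A x) ** Y ** A x = 0 \<Longrightarrow> Y = 0" for Y
    by (rule lyapunov_eq_0[OF assms(3)])
  show "\<forall>\<^sub>F y in nhds x. lyap (A y) (S y) - transpose (A y) ** lyap (A y) (S y) ** A y = S y"
    using eventually_spectral_radius_less_1[OF cont assms(3)]
    by eventually_elim (intro lyap_eq stable_if_spectral_radius)
  show "\<forall>\<^sub>F y in nhds x. \<forall>Z. norm ((Z - transpose (A y) ** Z ** A y)
      - (Z - transpose (A x) ** Z ** A x)) \<le> e * norm Z" if "e > 0" for e
    using eventually_congruence_diff_le[OF cont that] by simp
  let ?W' = "\<lambda>h. S' h + (transpose (A' h) ** Z ** A x + transpose (A x) ** Z ** A' h)"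
  have "((\<lambda>y. S y - (Z - transpose (A y) ** Z ** A y)) has_derivative
      (\<lambda>h. S' h - (0 - (transpose (A x) ** Z ** A' h + (transpose (A x) ** 0 + transpose (A' h) ** Z) ** A x)))) (at x)"
    by (intro has_derivative_diff has_derivative_const matrix_mult_has_derivative
        bounded_linear.has_derivative[OF bounded_linear_transpose] A S)
  then show "((\<lambda>y. S y - (lyap (A x) (S x) - transpose (A y) ** lyap (A x) (S x) ** A y))
      has_derivative ?W') (at x)"
    by (simp add: Z_def algebra_simps)
  show "lyap (A x) (?W' h) - transpose (A x) ** lyap (A x) (?W' h) ** A x = ?W' h" for h
    by (rule lyap_eq[OF assms(3)])
qed

section \<open>First and second derivative of the cost\<close>


lemma moment_inner_nonneg:
  assumes "integrable D outer_square" "psd N"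
  shows "0 \<le> N \<bullet> second_moment D"
proof -
  have "N \<bullet> second_moment D = (LINT x|D. N \<bullet> outer_square x)"
    unfolding second_moment_def using assms(1) by (intro integral_inner_right[symmetric])
  also have "\<dots> \<ge> 0"
    using assms(2) by (intro integral_nonneg_AE) (simp add: inner_outer_square psd_def)
  finally show ?thesis .
qed

text \<open>By Cauchy-Schwarz q P - (P y)(P y)^T is semidefinite for q = y^T P y. Pairing it with X0
  yields m |P y|^2 <= q tr(P X0), and q <= |y| |P y| finishes. This is the source of alpha /
  mu.\<close>

lemma second_moment_lower_bound:
  assumes int: "integrable D outer_square" and P: "psd P" and "0 < m"
    and m: "\<And>x. m * (norm x)\<^sup>2 \<le> x \<bullet> (second_moment D *v x)"
  shows "y \<bullet> (P *v y) \<le> (P \<bullet> second_moment D) / m * (norm y)\<^sup>2"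
proof -
  define q where "q = y \<bullet> (P *v y)"
  define J where "J = P \<bullet> second_moment D"
  define N where "N = q *\<^sub>R P - outer_square (P *v y)"
  have q: "q \<ge> 0" using P by (simp add: q_def psd_def)
  have J: "J \<ge> 0" unfolding J_def by (rule moment_inner_nonneg[OF int P])
  have outer: "x \<bullet> (outer_square (P *v y) *v x) = (y \<bullet> (P *v x))\<^sup>2" for x
  proof -
    have "x \<bullet> (outer_square (P *v y) *v x) = (x \<bullet> (P *v y))\<^sup>2"
      by (simp add: inner_vec_def outer_square_def matrix_vector_mult_def[of "vec_lambda _"] power2_eq_square sum_product
          sum_distrib_left mult_ac)
    also have "x \<bullet> (P *v y) = y \<bullet> (P *v x)"
      using P unfolding psd_def by (metis inner_commute inner_matrix_vector_mult)
    finally show ?thesis .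
  qed
  have "psd N" unfolding psd_def
  proof (intro conjI allI)
    have "transpose (outer_square (P *v y)) = outer_square (P *v y)"
      by (simp add: vec_eq_iff transpose_def outer_square_def mult.commute)
    then show "transpose N = N"
      using P by (simp add: N_def transpose_diff transpose_scalar psd_def)
    show "0 \<le> x \<bullet> (N *v x)" for x
      using psd_Cauchy_Schwarz[OF P, of y x]
      by (simp add: N_def matrix_vector_mult_diff_rdistrib inner_diff_right outer q_def
          flip: scaleR_matrix_vector_assoc)
  qed
  then have "0 \<le> N \<bullet> second_moment D" by (rule moment_inner_nonneg[OF int])
  then have "outer_square (P *v y) \<bullet> second_moment D \<le> q * J"
    by (simp add: N_def inner_diff_left J_def)
  moreover have "outer_square (P *v y) \<bullet> second_moment D = (P *v y) \<bullet> (second_moment D *v (P *v y))"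
    by (simp add: inner_commute[of "outer_square _"] inner_outer_square)
  ultimately have 1: "m * (norm (P *v y))\<^sup>2 \<le> q * J" using m[of "P *v y"] by simp
  have "q \<le> norm y * norm (P *v y)" unfolding q_def by (rule norm_cauchy_schwarz)
  then have "q\<^sup>2 \<le> (norm y)\<^sup>2 * (norm (P *v y))\<^sup>2"
    using q by (metis power_mono power_mult_distrib)
  then have "m * q\<^sup>2 \<le> (norm y)\<^sup>2 * (m * (norm (P *v y))\<^sup>2)"
    using \<open>0 < m\<close> by (simp add: mult.left_commute)
  also have "\<dots> \<le> (norm y)\<^sup>2 * (q * J)"
    by (intro mult_left_mono 1) simp
  finally have "(m * q) * q \<le> ((norm y)\<^sup>2 * J) * q" by (simp add: power2_eq_square mult_ac)
  then have "m * q \<le> (norm y)\<^sup>2 * J"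
    using q J \<open>0 < m\<close> by (cases "q = 0") auto
  then show ?thesis using \<open>0 < m\<close> unfolding q_def[symmetric] J_def[symmetric]
    by (simp add: field_simps)
qed

lemma inner_mat_1: "mat 1 \<bullet> (X :: real^'n^'n) = trace X"
  by (simp add: inner_vec_def mat_def trace_def if_distrib if_distribR cong: if_cong)

lemma psd_diff_mat:
  assumes "psd S" "\<And>x. s * (norm x)\<^sup>2 \<le> x \<bullet> (S *v x)"
  shows "psd (S - s *\<^sub>R mat 1)"
  using assms unfolding psd_def
  by (auto simp: transpose_diff transpose_scalar matrix_vector_mult_diff_rdistrib inner_diff_right
      dot_square_norm simp del: transpose_matrix_vector simp flip: scaleR_matrix_vector_assoc)

text \<open>By duality tr X is the pairing of X0 with the solution for source \<open>mat 1\<close>.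
  As s I <= S, that solution is at most \<open>lyap A S\<close> divided by s in the semidefinite
  order.\<close>

lemma trace_lyap_le:
  fixes A S :: "real^'n^'n"
  assumes A: "stable A" and int: "integrable D outer_square" and S: "psd S" and "0 < s"
    and s: "\<And>x. s * (norm x)\<^sup>2 \<le> x \<bullet> (S *v x)"
  shows "trace (lyap (transpose A) (second_moment D)) \<le> (lyap A S \<bullet> second_moment D) / s"
proof -
  have "0 \<le> lyap A (S - s *\<^sub>R mat 1) \<bullet> second_moment D"
    by (intro moment_inner_nonneg int lyap_psd A psd_diff_mat S s)
  also have "lyap A (S - s *\<^sub>R mat 1) \<bullet> second_moment D
      = lyap A S \<bullet> second_moment D - s * (lyap A (mat 1) \<bullet> second_moment D)"
    by (simp add: lyap_diff[OF A] lyap_scaleR[OF A] inner_diff_left)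
  also have "lyap A (mat 1) \<bullet> second_moment D = trace (lyap (transpose A) (second_moment D))"
    by (simp add: lyap_duality[OF A] inner_mat_1)
  finally show ?thesis using \<open>0 < s\<close> by (simp add: field_simps)
qed

lemma inner_state_covariance_le:
  fixes A Y :: "real^'n^'n"
  assumes "stable A" "psd Y"
  shows "A \<bullet> (A ** lyap (transpose A) Y) \<le> trace (lyap (transpose A) Y)"
proof -
  let ?X = "lyap (transpose A) Y"
  have "A ** ?X ** transpose A = ?X - Y"
    using lyap_eq[OF stable_transpose[OF assms(1)], of Y] by (simp add: algebra_simps)
  moreover have "mat 1 \<bullet> (A ** ?X ** transpose A) = A \<bullet> (A ** ?X)"
    by (simp only: inner_matrix_mult_right[of "mat 1" "A ** ?X"] transpose_transpose matrix_mul_lid)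
  ultimately have "A \<bullet> (A ** ?X) = trace ?X - trace Y"
    by (simp add: inner_diff_right inner_mat_1)
  then show ?thesis using psd_trace_nonneg[OF assms(2)] by simp
qed

locale sof =
  fixes A :: "real^'n^'n" and B :: "real^'m^'n" and C :: "real^'n^'d"
    and Q :: "real^'n^'n" and R :: "real^'m^'m" and D :: "(real^'n) measure"
  assumes Q: "pos_def_mat Q" and R: "pos_def_mat R"
    and int: "integrable D outer_square" and moment: "pos_def_mat (second_moment D)"
begin

abbreviation cl :: "real^'d^'m \<Rightarrow> real^'n^'n"
  where "cl K \<equiv> closed_loop A B C K"

abbreviation weight :: "real^'d^'m \<Rightarrow> real^'n^'n"
  where "weight K \<equiv> stage_weight C Q R K"

abbreviation cost :: "real^'d^'m \<Rightarrow> real"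
  where "cost K \<equiv> sof_cost D A B C Q R K"

text \<open>\<^const>\<open>closed_loop\<close>, \<open>value_mat\<close>, \<open>covar\<close> and \<open>policy_residual\<close> are \<open>\<A>\<^sub>K\<close>, \<open>P\<^sub>K\<close>,
  \<open>X\<^sub>K = \<Sum>\<^sub>t \<A>\<^sub>K\<^sup>t X\<^sub>0 (\<A>\<^sub>K\<^sup>t)\<^sup>T\<close> and \<open>R K C - B\<^sup>T P\<^sub>K \<A>\<^sub>K\<close>.\<close>

definition value_mat :: "real^'d^'m \<Rightarrow> real^'n^'n"
  where "value_mat K = lyap (cl K) (weight K)"

definition covar :: "real^'d^'m \<Rightarrow> real^'n^'n"
  where "covar K = lyap (transpose (cl K)) (second_moment D)"

definition policy_residual :: "real^'d^'m \<Rightarrow> real^'n^'m"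
  where "policy_residual K = R ** K ** C - transpose B ** value_mat K ** cl K"

text \<open>The derivative of P in direction E: the contributions of the stage weight and of the
  closed loop combine into the residual.\<close>

definition value_deriv :: "real^'d^'m \<Rightarrow> real^'d^'m \<Rightarrow> real^'n^'n"
  where "value_deriv K E = lyap (cl K)
    (transpose (E ** C) ** policy_residual K + transpose (policy_residual K) ** (E ** C))"

definition grad :: "real^'d^'m \<Rightarrow> real^'d^'m"
  where "grad K = 2 *\<^sub>R (policy_residual K ** covar K ** transpose C)"

definition residual_deriv :: "real^'d^'m \<Rightarrow> real^'d^'m \<Rightarrow> real^'n^'m"
  where "residual_deriv K E = R ** E ** C - transpose B ** value_deriv K E ** cl K
    + transpose B ** value_mat K ** (B ** E ** C)"

definition covar_deriv :: "real^'d^'m \<Rightarrow> real^'d^'m \<Rightarrow> real^'n^'n"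
  where "covar_deriv K E = lyap (transpose (cl K))
    (- (B ** E ** C ** covar K ** transpose (cl K) + cl K ** covar K ** transpose (B ** E ** C)))"

definition grad_deriv :: "real^'d^'m \<Rightarrow> real^'d^'m \<Rightarrow> real^'d^'m"
  where "grad_deriv K E = 2 *\<^sub>R ((residual_deriv K E ** covar K
    + policy_residual K ** covar_deriv K E) ** transpose C)"

lemma stable_cl: "K \<in> stabilizing A B C \<Longrightarrow> stable (cl K)"
  by (simp add: stabilizing_def stable_if_spectral_radius)

lemma R_sym: "transpose R = R" and Q_sym: "transpose Q = Q"
  using R Q by (auto simp: pos_def_mat_def)

lemma inner_weight: "x \<bullet> (weight K *v x) = x \<bullet> (Q *v x) + (K *v (C *v x)) \<bullet> (R *v (K *v (C *v x)))"
proof -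
  have "weight K = Q + transpose (K ** C) ** R ** (K ** C)"
    by (simp add: stage_weight_def matrix_transpose_mul matrix_mul_assoc)
  then show ?thesis
    by (simp only: matrix_vector_mult_add_rdistrib inner_add_right inner_congruence matrix_vector_mul_assoc)
qed

lemma weight_psd: "psd (weight K)"
  unfolding psd_def
proof (intro conjI allI)
  show "transpose (weight K) = weight K"
    by (simp add: stage_weight_def transpose_add matrix_transpose_mul R_sym Q_sym matrix_mul_assoc)
  show "0 \<le> x \<bullet> (weight K *v x)" for x
    using psd_if_pos_def[OF Q] psd_if_pos_def[OF R] unfolding inner_weight psd_def by (simp add: add_nonneg_nonneg)
qed

lemma value_mat_psd: "K \<in> stabilizing A B C \<Longrightarrow> psd (value_mat K)"
  unfolding value_mat_def by (intro lyap_psd stable_cl weight_psd)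

lemma covar_psd: "K \<in> stabilizing A B C \<Longrightarrow> psd (covar K)"
  unfolding covar_def by (intro lyap_psd stable_transpose stable_cl psd_if_pos_def moment)

section \<open>Differentiation of the cost\<close>

lemma cost_eq:
  assumes "K \<in> stabilizing A B C"
  shows "cost K = value_mat K \<bullet> second_moment D"
proof -
  have "(\<Sum>t. trajectory A B C K x t \<bullet> (weight K *v trajectory A B C K x t)) = value_mat K \<bullet> outer_square x" for x
    unfolding trajectory_def value_mat_def inner_outer_square
    by (rule sums_unique[symmetric]) (intro lyapunov_sums lyap_eq stable_cl assms)
  then have "cost K = (LINT x|D. value_mat K \<bullet> outer_square x)"
    by (simp add: sof_cost_def)
  also have "\<dots> = value_mat K \<bullet> second_moment D"
    unfolding second_moment_def using int by (intro integral_inner_right)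
  finally show ?thesis .
qed

lemma closed_loop_has_derivative: "(cl has_derivative (\<lambda>E. - (B ** E ** C))) (at K)"
proof -
  have "((\<lambda>K. A - B ** K ** C) has_derivative
      (\<lambda>E. 0 - ((B ** K) ** 0 + (B ** E + 0 ** K) ** C))) (at K)"
    by (intro has_derivative_diff has_derivative_const matrix_mult_has_derivative has_derivative_ident)
  then show ?thesis unfolding closed_loop_def[abs_def] by simp
qed

lemma weight_has_derivative:
  "(weight has_derivative (\<lambda>E. transpose (E ** C) ** (R ** K ** C) + transpose (R ** K ** C) ** (E ** C))) (at K)"
proof -
  have "((\<lambda>K. Q + transpose C ** transpose K ** R ** K ** C) has_derivative
    (\<lambda>E. 0 + ((transpose C ** transpose K ** R ** K) ** 0 +
      ((transpose C ** transpose K ** R) ** E + ((transpose C ** transpose K) ** 0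
        + (transpose C ** transpose E + 0 ** transpose K) ** R) ** K) ** C))) (at K)"
    by (intro has_derivative_add has_derivative_const matrix_mult_has_derivative has_derivative_ident
       bounded_linear.has_derivative[OF bounded_linear_transpose])
  then show ?thesis unfolding stage_weight_def[abs_def]
    by (rule has_derivative_eq_rhs)
      (simp add: fun_eq_iff matrix_transpose_mul R_sym matrix_mul_assoc matrix_mult.add_left add.commute)
qed

lemma value_mat_has_derivative:
  assumes "K \<in> stabilizing A B C"
  shows "(value_mat has_derivative value_deriv K) (at K)"
proof -
  have P: "transpose (value_mat K) = value_mat K" using value_mat_psd[OF assms] by (simp add: psd_def)
  show ?thesis
    unfolding value_mat_def[abs_def]
    by (rule has_derivative_eq_rhs[OF lyap_has_derivative[OF closed_loop_has_derivative
            weight_has_derivative stable_cl[OF assms]]])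
      (simp add: fun_eq_iff value_deriv_def policy_residual_def P transpose_diff transpose_uminus
        matrix_transpose_mul matrix_mul_assoc matrix_mult.diff_left matrix_mult.diff_right matrix_mult.minus_left matrix_mult.minus_right
        algebra_simps flip: value_mat_def)
qed

lemma covar_has_derivative:
  assumes "K \<in> stabilizing A B C"
  shows "(covar has_derivative covar_deriv K) (at K)"
  unfolding covar_def[abs_def]
  by (rule has_derivative_eq_rhs[OF lyap_has_derivative[OF
        bounded_linear.has_derivative[OF bounded_linear_transpose closed_loop_has_derivative]
        has_derivative_const stable_transpose[OF stable_cl[OF assms]]]])
    (simp add: fun_eq_iff covar_deriv_def transpose_uminus matrix_mult.minus_left matrix_mult.minus_right
      algebra_simps flip: covar_def)

lemma policy_residual_has_derivative:
  assumes "K \<in> stabilizing A B C"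
  shows "(policy_residual has_derivative residual_deriv K) (at K)"
proof -
  have "((\<lambda>K. R ** K ** C - transpose B ** value_mat K ** cl K) has_derivative
    (\<lambda>E. ((R ** K) ** 0 + (R ** E + 0 ** K) ** C) -
      ((transpose B ** value_mat K) ** - (B ** E ** C) +
        (transpose B ** value_deriv K E + 0 ** value_mat K) ** cl K))) (at K)"
    by (intro has_derivative_diff has_derivative_const matrix_mult_has_derivative has_derivative_ident
      value_mat_has_derivative closed_loop_has_derivative assms)
  then show ?thesis unfolding policy_residual_def[abs_def]
    by (rule has_derivative_eq_rhs)
      (simp add: fun_eq_iff residual_deriv_def matrix_mult.minus_right algebra_simps)
qed

lemma grad_has_derivative:
  assumes "K \<in> stabilizing A B C"
  shows "(grad has_derivative grad_deriv K) (at K)"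
proof -
  have "((\<lambda>K. 2 *\<^sub>R (policy_residual K ** covar K ** transpose C)) has_derivative
    (\<lambda>E. 2 *\<^sub>R ((policy_residual K ** covar K) ** 0 +
      (policy_residual K ** covar_deriv K E + residual_deriv K E ** covar K) ** transpose C))) (at K)"
    by (intro has_derivative_scaleR_right has_derivative_const matrix_mult_has_derivative
      policy_residual_has_derivative covar_has_derivative assms)
  then show ?thesis unfolding grad_def[abs_def]
    by (rule has_derivative_eq_rhs) (simp add: fun_eq_iff grad_deriv_def add.commute)
qed

text \<open>Duality moves the operator onto Y, and symmetry makes both halves of the source
  contribute equally. Y = X0 gives the gradient.\<close>

lemma inner_value_deriv:
  assumes "K \<in> stabilizing A B C" and "transpose Y = Y"
  shows "value_deriv K E \<bullet> Y = 2 * ((E ** C) \<bullet> (policy_residual K ** lyap (transpose (cl K)) Y))"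
proof -
  let ?G = "policy_residual K" and ?X = "lyap (transpose (cl K)) Y"
  have X: "transpose ?X = ?X"
    using lyap_transpose[OF stable_transpose[OF stable_cl[OF assms(1)]], of Y] assms(2) by simp
  have "(E ** C) \<bullet> (?G ** ?X) = (transpose ?G ** (E ** C)) \<bullet> ?X"
    by (rule inner_matrix_mult_left)
  moreover have "(transpose ?G ** (E ** C)) \<bullet> ?X = (transpose (E ** C) ** ?G) \<bullet> ?X"
    using inner_transpose_transpose[of "transpose ?G ** (E ** C)" ?X]
    by (simp add: X matrix_transpose_mul)
  ultimately show ?thesis
    unfolding value_deriv_def lyap_duality[OF stable_cl[OF assms(1)]] inner_add_left by linarith
qed

lemma eventually_stabilizing:
  assumes "K \<in> stabilizing A B C"
  shows "\<forall>\<^sub>F K' in nhds K. K' \<in> stabilizing A B C"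
proof -
  have "isCont cl K"
    using closed_loop_has_derivative has_derivative_continuous continuous_at by blast
  then show ?thesis
    unfolding stabilizing_def mem_Collect_eq
    by (rule eventually_spectral_radius_less_1) (rule stable_cl[OF assms])
qed

lemma cost_has_derivative:
  assumes "K \<in> stabilizing A B C"
  shows "(cost has_derivative (\<lambda>E. grad K \<bullet> E)) (at K)"
proof -
  have "((\<lambda>K. value_mat K \<bullet> second_moment D) has_derivative (\<lambda>E. value_deriv K E \<bullet> second_moment D)) (at K)"
    by (intro has_derivative_inner_left value_mat_has_derivative assms)
  moreover have "value_deriv K E \<bullet> second_moment D = grad K \<bullet> E" for E
  proof -
    have "value_deriv K E \<bullet> second_moment D = 2 * ((E ** C) \<bullet> (policy_residual K ** covar K))"
      unfolding covar_def using moment by (intro inner_value_deriv assms) (simp add: pos_def_mat_def)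
    also have "\<dots> = grad K \<bullet> E"
      using inner_matrix_mult_right[of "policy_residual K ** covar K" E C]
      by (simp add: grad_def inner_commute)
    finally show ?thesis .
  qed
  ultimately have "((\<lambda>K. value_mat K \<bullet> second_moment D) has_derivative (\<lambda>E. grad K \<bullet> E)) (at K)" by simp
  \<comment> \<open>The two functions are known to agree only on stabilizing gains, so openness
    enters here.\<close>
  then show ?thesis
  proof (rule has_derivative_transform_eventually)
    show "\<forall>\<^sub>F K' in at K. value_mat K' \<bullet> second_moment D = cost K'"
      using eventually_stabilizing[OF assms] unfolding eventually_at_filter
      by eventually_elim (simp add: cost_eq)
  qed (simp_all add: cost_eq assms)
qed

lemma value_deriv_sym:
  assumes "K \<in> stabilizing A B C"
  shows "transpose (value_deriv K E) = value_deriv K E"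
  unfolding value_deriv_def lyap_transpose[OF stable_cl[OF assms]]
  by (simp add: transpose_add matrix_transpose_mul add.commute)

lemma inner_grad_deriv:
  assumes "K \<in> stabilizing A B C"
  shows "E \<bullet> grad_deriv K F =
    2 * ((E ** C) \<bullet> ((R + transpose B ** value_mat K ** B) ** (F ** C) ** covar K))
    - 2 * ((value_deriv K F ** (B ** (E ** C))) \<bullet> (cl K ** covar K))
    - 2 * ((value_deriv K E ** (B ** (F ** C))) \<bullet> (cl K ** covar K))"
proof -
  let ?P = "value_mat K" and ?X = "covar K" and ?G = "policy_residual K" and ?T = "cl K"
  let ?Y = "B ** F ** C ** ?X ** transpose ?T"
  have X: "transpose ?X = ?X" using covar_psd[OF assms] by (simp add: psd_def)
  have "E \<bullet> grad_deriv K F = 2 * ((E ** C) \<bullet> (residual_deriv K F ** ?X))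
      + 2 * ((E ** C) \<bullet> (?G ** covar_deriv K F))"
    by (simp add: grad_deriv_def inner_matrix_mult_right inner_add_right)
  \<comment> \<open>\<open>inner_value_deriv\<close> from right to left: the derivative of X solves
    the transposed equation with a symmetric source, so it can be traded for the derivative of
    P.\<close>
  also have "2 * ((E ** C) \<bullet> (?G ** covar_deriv K F)) = value_deriv K E \<bullet> (- (?Y + transpose ?Y))"
    unfolding covar_deriv_def
    by (subst inner_value_deriv[OF assms])
      (simp_all add: transpose_uminus transpose_add transpose_diff matrix_transpose_mul matrix_mul_assoc X add.commute)
  also have "\<dots> = - 2 * (value_deriv K E \<bullet> ?Y)"
    using inner_transpose_transpose[of "value_deriv K E" ?Y]
    by (simp add: value_deriv_sym[OF assms] inner_add_right inner_diff_right)
  also have "value_deriv K E \<bullet> ?Y = (value_deriv K E ** (B ** (F ** C))) \<bullet> (?T ** ?X)"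
  proof -
    have "value_deriv K E \<bullet> ?Y = (value_deriv K E ** ?T) \<bullet> (B ** F ** C ** ?X)"
      by (simp add: inner_matrix_mult_right[of _ "B ** F ** C ** ?X"])
    also have "\<dots> = (value_deriv K E ** ?T ** ?X) \<bullet> (B ** F ** C)"
      by (simp add: inner_matrix_mult_right[of _ "B ** F ** C"] X)
    also have "\<dots> = (?T ** ?X) \<bullet> (value_deriv K E ** (B ** F ** C))"
      using inner_matrix_mult_left[of "?T ** ?X" "value_deriv K E" "B ** F ** C"]
      by (simp add: inner_commute inner_matrix_mult_left[of "B ** F ** C" "value_deriv K E"]
          value_deriv_sym[OF assms] matrix_mul_assoc)
    finally show ?thesis by (simp add: inner_commute matrix_mul_assoc)
  qed
  also have "residual_deriv K F ** ?X = (R + transpose B ** ?P ** B) ** (F ** C) ** ?X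
      - transpose B ** (value_deriv K F ** (?T ** ?X))"
    by (simp add: residual_deriv_def matrix_mult.add_left matrix_mult.diff_left matrix_mul_assoc)
  also have "(E ** C) \<bullet> (\<dots>) = (E ** C) \<bullet> ((R + transpose B ** ?P ** B) ** (F ** C) ** ?X)
      - (value_deriv K F ** (B ** (E ** C))) \<bullet> (?T ** ?X)"
    by (simp add: inner_diff_right inner_matrix_mult_left[of _ "transpose B"]
        inner_matrix_mult_left[of _ "value_deriv K F"] value_deriv_sym[OF assms])
  finally show ?thesis by simp
qed
end

section \<open>Bounds\<close>


context sof begin

lemma mat_norm_value_mat:
  assumes "K \<in> stabilizing A B C" "cost K \<le> \<alpha>"
  shows "mat_norm (value_mat K) \<le> \<alpha> / sigma_min (second_moment D)"
proof (rule mat_norm_le_if_quadratic)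
  let ?\<mu> = "sigma_min (second_moment D)"
  have psd: "psd (value_mat K)" by (rule value_mat_psd[OF assms(1)])
  then show "transpose (value_mat K) = value_mat K" by (simp add: psd_def)
  fix x
  have "x \<bullet> (value_mat K *v x) \<le> cost K / ?\<mu> * (norm x)\<^sup>2"
    unfolding cost_eq[OF assms(1)]
    by (intro second_moment_lower_bound int psd sigma_min_pos_def moment)
  also have "\<dots> \<le> \<alpha> / ?\<mu> * (norm x)\<^sup>2"
    using sigma_min_pos_def(1)[OF moment] assms(2)
    by (intro mult_right_mono divide_right_mono) auto
  finally show "\<bar>x \<bullet> (value_mat K *v x)\<bar> \<le> \<alpha> / ?\<mu> * (norm x)\<^sup>2"
    using psd by (simp add: psd_def)
qed

lemma sigma_min_le_inner_weight: "sigma_min Q * (norm x)\<^sup>2 \<le> x \<bullet> (weight K *v x)"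
  using sigma_min_pos_def(2)[OF Q, of x] psd_if_pos_def[OF R]
  unfolding inner_weight psd_def by (meson add_increasing2 order_trans)

lemma trace_covar:
  assumes "K \<in> stabilizing A B C" "cost K \<le> \<alpha>"
  shows "trace (covar K) \<le> \<alpha> / sigma_min Q"
proof -
  have "trace (covar K) \<le> cost K / sigma_min Q"
    unfolding cost_eq[OF assms(1)] unfolding covar_def value_mat_def
    by (intro trace_lyap_le stable_cl assms int weight_psd sigma_min_pos_def Q sigma_min_le_inner_weight)
  also have "\<dots> \<le> \<alpha> / sigma_min Q"
    using sigma_min_pos_def(1)[OF Q] assms(2) by (intro divide_right_mono) auto
  finally show ?thesis .
qed

text \<open>zeta1, with any bound \<open>p\<close> of the norm of P in place of alpha / mu.\<close>

definition zeta :: "real \<Rightarrow> real"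
  where "zeta p = 1 / sigma_min Q *
    (p * (1 + (mat_norm B)\<^sup>2 * (mat_norm C)\<^sup>2) + mat_norm R * (mat_norm C)\<^sup>2) - 1"

text \<open>With u = E C x and v = K C x, the form splits into u^T R v and (B u)^T P A_K x. After
  AM-GM the squares in v and A_K x combine, by the Lyapunov equation, into x^T P x - x^T Q x, so no
  bound on K or A_K enters; the squares in u use |u| <= |C| |x|.\<close>

lemma inner_value_deriv_source:
  assumes K: "K \<in> stabilizing A B C" and p: "mat_norm (value_mat K) \<le> p" and E: "mat_norm E \<le> 1"
  shows "2 * \<bar>(E *v (C *v x)) \<bullet> (policy_residual K *v x)\<bar> \<le> zeta p * (x \<bullet> (Q *v x))"
proof -
  let ?P = "value_mat K" and ?T = "cl K"
  define u where "u = E *v (C *v x)"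
  define v where "v = K *v (C *v x)"
  have psd: "psd ?P" by (rule value_mat_psd[OF K])
  have quad: "y \<bullet> (?P *v y) \<le> p * (norm y)\<^sup>2" for y
    using inner_matrix_vector_le[of y ?P y] mult_right_mono[OF p, of "(norm y)\<^sup>2"]
    by (simp add: power2_eq_square)
  have "norm u \<le> mat_norm E * norm (C *v x)" unfolding u_def by (rule norm_matrix_vector_mult)
  also have "\<dots> \<le> 1 * (mat_norm C * norm x)"
    by (intro mult_mono E norm_matrix_vector_mult) auto
  finally have u: "(norm u)\<^sup>2 \<le> (mat_norm C)\<^sup>2 * (norm x)\<^sup>2"
    by (simp add: power_mono flip: power_mult_distrib)
  have p0: "0 \<le> p" using p mat_norm_nonneg order_trans by blast
  have "policy_residual K *v x = R *v v - transpose B *v (?P *v (?T *v x))"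
    by (simp only: policy_residual_def v_def matrix_vector_mult_diff_rdistrib matrix_vector_mul_assoc matrix_mul_assoc)
  then have "u \<bullet> (policy_residual K *v x) = u \<bullet> (R *v v) - (B *v u) \<bullet> (?P *v (?T *v x))"
    using inner_matrix_vector_mult[of u "transpose B"] by (simp only: inner_diff_right transpose_transpose)
  then have "2 * \<bar>u \<bullet> (policy_residual K *v x)\<bar>
      \<le> 2 * \<bar>u \<bullet> (R *v v)\<bar> + 2 * \<bar>(B *v u) \<bullet> (?P *v (?T *v x))\<bar>" by linarith
  also have "\<dots> \<le> (u \<bullet> (R *v u) + v \<bullet> (R *v v))
      + ((B *v u) \<bullet> (?P *v (B *v u)) + (?T *v x) \<bullet> (?P *v (?T *v x)))"
    by (intro add_mono psd_amgm psd psd_if_pos_def R)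
  \<comment> \<open>The term in v cancels the one from AM-GM; the surviving - x^T Q x becomes the -1
    in \<open>zeta\<close>.\<close>
  also have "(?T *v x) \<bullet> (?P *v (?T *v x)) = x \<bullet> (?P *v x) - x \<bullet> (Q *v x) - v \<bullet> (R *v v)"
    using lyapunov_step[OF lyap_eq[OF stable_cl[OF K]], of x "weight K" x]
    unfolding inner_weight value_mat_def v_def by simp
  finally have 1: "2 * \<bar>u \<bullet> (policy_residual K *v x)\<bar>
      \<le> u \<bullet> (R *v u) + (B *v u) \<bullet> (?P *v (B *v u)) + x \<bullet> (?P *v x) - x \<bullet> (Q *v x)" by simp
  have 2: "u \<bullet> (R *v u) \<le> mat_norm R * ((mat_norm C)\<^sup>2 * (norm x)\<^sup>2)"
    using inner_matrix_vector_le[of u R u] mult_left_mono[OF u mat_norm_nonneg[of R]]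
    by (simp add: power2_eq_square)
  have "(norm (B *v u))\<^sup>2 \<le> (mat_norm B)\<^sup>2 * (norm u)\<^sup>2"
    using norm_matrix_vector_mult[of B u] by (simp add: power_mono flip: power_mult_distrib)
  also have "\<dots> \<le> (mat_norm B)\<^sup>2 * ((mat_norm C)\<^sup>2 * (norm x)\<^sup>2)"
    using u by (rule mult_left_mono) simp
  finally have 3: "(B *v u) \<bullet> (?P *v (B *v u)) \<le> p * ((mat_norm B)\<^sup>2 * ((mat_norm C)\<^sup>2 * (norm x)\<^sup>2))"
    using quad[of "B *v u"] p0 by (meson mult_left_mono order_trans)
  let ?k = "p * (1 + (mat_norm B)\<^sup>2 * (mat_norm C)\<^sup>2) + mat_norm R * (mat_norm C)\<^sup>2"
  have "2 * \<bar>u \<bullet> (policy_residual K *v x)\<bar> \<le> ?k * (norm x)\<^sup>2 - x \<bullet> (Q *v x)"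
    using 1 2 3 quad[of x] by (simp add: algebra_simps)
  \<comment> \<open>A bound relative to Q rather than to |x|^2 is comparable with the stage weight,
    the source of P.\<close>
  also have "?k * (norm x)\<^sup>2 \<le> ?k * (x \<bullet> (Q *v x) / sigma_min Q)"
    using sigma_min_pos_def(1)[OF Q] sigma_min_pos_def(2)[OF Q, of x] p0 mat_norm_nonneg[of R]
    by (intro mult_left_mono add_nonneg_nonneg mult_nonneg_nonneg) (simp_all add: field_simps)
  also have "?k * (x \<bullet> (Q *v x) / sigma_min Q) - x \<bullet> (Q *v x) = zeta p * (x \<bullet> (Q *v x))"
    by (simp add: zeta_def algebra_simps)
  finally show ?thesis by (simp add: u_def)
qed

text \<open>The -1 hides the sign; E = 0 in the preceding bound reveals it. It allows Q to be
  enlarged to the stage weight below.\<close>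

lemma zeta_nonneg:
  assumes "K \<in> stabilizing A B C" "mat_norm (value_mat K) \<le> p"
  shows "0 \<le> zeta p"
proof -
  let ?x = "axis undefined 1 :: real^'n"
  have "0 \<le> zeta p * (?x \<bullet> (Q *v ?x))"
    using inner_value_deriv_source[OF assms, of 0 ?x] by (simp add: mat_norm_def onorm_zero)
  moreover have "0 < ?x \<bullet> (Q *v ?x)"
    using Q unfolding pos_def_mat_def by (metis axis_eq_0_iff zero_neq_one)
  ultimately show ?thesis by (simp add: zero_le_mult_iff)
qed

text \<open>Both \<open>\<zeta> S \<plusminus> (M + M\<^sup>T)\<close> are positive semidefinite, where \<open>S\<close> is the stage weight and
  \<open>M + M\<^sup>T\<close> the source of the Lyapunov equation of the derivative; hence so are their
  solutions \<open>\<zeta> P \<plusminus> P'\<close>.\<close>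

lemma mat_norm_value_deriv:
  assumes K: "K \<in> stabilizing A B C" and p: "mat_norm (value_mat K) \<le> p" and E: "mat_norm E \<le> 1"
  shows "mat_norm (value_deriv K E) \<le> zeta p * p"
proof (rule mat_norm_le_if_quadratic)
  let ?N = "transpose (E ** C) ** policy_residual K + transpose (policy_residual K) ** (E ** C)"
  have N: "x \<bullet> (?N *v x) = 2 * ((E *v (C *v x)) \<bullet> (policy_residual K *v x))" for x
  proof -
    have "x \<bullet> ((transpose U ** V) *v x) = (U *v x) \<bullet> (V *v x)" for U V :: "real^'n^'m"
      using inner_matrix_vector_mult[of x "transpose U" "V *v x"]
      by (simp only: matrix_vector_mul_assoc transpose_transpose)
    then show ?thesis
      by (simp only: matrix_vector_mult_add_rdistrib inner_add_right matrix_vector_mul_assoc)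
        (simp add: inner_commute)
  qed
  have N_sym: "transpose ?N = ?N"
    by (simp add: transpose_add matrix_transpose_mul add.commute)
  have z: "0 \<le> zeta p" by (rule zeta_nonneg[OF K p])
  have bound: "\<bar>x \<bullet> (?N *v x)\<bar> \<le> zeta p * (x \<bullet> (weight K *v x))" for x
  proof -
    have "\<bar>x \<bullet> (?N *v x)\<bar> \<le> zeta p * (x \<bullet> (Q *v x))"
      using inner_value_deriv_source[OF K p E, of x] by (simp only: N abs_mult abs_numeral)
    also have "\<dots> \<le> zeta p * (x \<bullet> (weight K *v x))"
      using z psd_if_pos_def[OF R] unfolding inner_weight psd_def by (intro mult_left_mono) auto
    finally show ?thesis .
  qed
  have w_sym: "transpose (weight K) = weight K" using weight_psd by (simp add: psd_def)
  have "psd (zeta p *\<^sub>R weight K + ?N)" "psd (zeta p *\<^sub>R weight K - ?N)"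
    unfolding psd_def transpose_add[of "_ *\<^sub>R _"] transpose_diff transpose_scalar N_sym w_sym
      matrix_vector_mult_add_rdistrib[of "_ *\<^sub>R _"] matrix_vector_mult_diff_rdistrib
      inner_add_right[of _ "_ *\<^sub>R _ *v _"] inner_diff_right
    using bound by (auto simp: abs_le_iff simp del: transpose_matrix_vector
      simp flip: scaleR_matrix_vector_assoc) (smt (verit) bound)+
  then have "psd (zeta p *\<^sub>R value_mat K + value_deriv K E)" "psd (zeta p *\<^sub>R value_mat K - value_deriv K E)"
    unfolding value_deriv_def value_mat_def lyap_scaleR[OF stable_cl[OF K], symmetric]
      lyap_add[OF stable_cl[OF K], symmetric, of "_ *\<^sub>R _"] lyap_diff[OF stable_cl[OF K], symmetric]
    by (simp_all only: lyap_psd stable_cl K)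
  then have "\<bar>x \<bullet> (value_deriv K E *v x)\<bar> \<le> zeta p * (x \<bullet> (value_mat K *v x))" for x
    unfolding psd_def matrix_vector_mult_add_rdistrib matrix_vector_mult_diff_rdistrib
      inner_add_right inner_diff_right scaleR_matrix_vector_assoc[symmetric] inner_scaleR_right
    by (smt (verit))
  moreover have "zeta p * (x \<bullet> (value_mat K *v x)) \<le> zeta p * p * (norm x)\<^sup>2" for x
  proof -
    have "x \<bullet> (value_mat K *v x) \<le> p * (norm x)\<^sup>2"
      using inner_matrix_vector_le[of x "value_mat K" x] mult_right_mono[OF p, of "(norm x)\<^sup>2"]
      by (simp add: power2_eq_square)
    then show ?thesis using mult_left_mono[OF _ z] by (simp add: mult.assoc)
  qed
  ultimately show "\<bar>x \<bullet> (value_deriv K E *v x)\<bar> \<le> zeta p * p * (norm x)\<^sup>2" for x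
    by (rule order_trans)
  show "transpose (value_deriv K E) = value_deriv K E" by (rule value_deriv_sym[OF K])
qed

lemma norm_gain_weight_mult_le:
  assumes "mat_norm (value_mat K) \<le> p"
  shows "norm ((R + transpose B ** value_mat K ** B) ** V) \<le> (mat_norm R + p * (mat_norm B)\<^sup>2) * norm V"
proof -
  let ?P = "value_mat K"
  have "norm ((R + transpose B ** ?P ** B) ** V) \<le> norm (R ** V) + norm (transpose B ** (?P ** (B ** V)))"
    by (simp add: matrix_mult.add_left norm_triangle_ineq matrix_mul_assoc)
  also have "norm (transpose B ** (?P ** (B ** V))) \<le> mat_norm (transpose B) * norm (?P ** (B ** V))"
    by (rule norm_matrix_mult_left)
  also have "\<dots> \<le> mat_norm B * (mat_norm ?P * norm (B ** V))"
    unfolding mat_norm_transpose by (intro mult_left_mono norm_matrix_mult_left mat_norm_nonneg)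
  also have "\<dots> \<le> mat_norm B * (p * (mat_norm B * norm V))"
    using order_trans[OF mat_norm_nonneg assms]
    by (intro mult_left_mono mult_mono norm_matrix_mult_left mat_norm_nonneg assms) auto
  finally show ?thesis
    using norm_matrix_mult_left[of R V] by (simp add: algebra_simps power2_eq_square)
qed

text \<open>The first trace pairs E C with (R + B^T P B) F C, the other two pair a matrix with A_K
  and differ by exchanging E and F, hence the factor 2 before \<open>zeta p\<close>. Frobenius norm
  1 also bounds the operator norm by 1, as \<open>mat_norm_value_deriv\<close> requires.\<close>

lemma inner_grad_deriv_bound:
  assumes K: "K \<in> stabilizing A B C" and p: "mat_norm (value_mat K) \<le> p"
    and \<tau>: "trace (covar K) \<le> \<tau>" and E: "norm E = 1" and F: "norm F = 1"
  shows "\<bar>E \<bullet> grad_deriv K F\<bar> \<le>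
    2 * \<tau> * ((mat_norm R + p * (mat_norm B)\<^sup>2) * (mat_norm C)\<^sup>2 + 2 * (zeta p * p * mat_norm B * mat_norm C))"
proof -
  let ?X = "covar K" and ?W = "R + transpose B ** value_mat K ** B"
  have psd: "psd ?X" by (rule covar_psd[OF K])
  have t0: "0 \<le> trace ?X" by (rule psd_trace_nonneg[OF psd])
  have p0: "0 \<le> p" using p mat_norm_nonneg order_trans by blast
  have z: "0 \<le> zeta p" by (rule zeta_nonneg[OF K p])
  have EC: "norm (G ** C) \<le> mat_norm C" if "norm G = 1" for G :: "real^'d^'m"
    using norm_matrix_mult_right[of G C] that by simp
  have "\<bar>(E ** C) \<bullet> (?W ** (F ** C) ** ?X)\<bar> \<le> trace ?X * (norm (E ** C) * norm (?W ** (F ** C)))"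
    by (rule psd_inner_le[OF psd])
  also have "\<dots> \<le> \<tau> * (mat_norm C * ((mat_norm R + p * (mat_norm B)\<^sup>2) * mat_norm C))"
  proof (intro mult_mono \<tau> EC E)
    have "norm (?W ** (F ** C)) \<le> (mat_norm R + p * (mat_norm B)\<^sup>2) * norm (F ** C)"
      by (rule norm_gain_weight_mult_le[OF p])
    also have "\<dots> \<le> (mat_norm R + p * (mat_norm B)\<^sup>2) * mat_norm C"
      using p0 mat_norm_nonneg[of R] by (intro mult_left_mono EC F) auto
    finally show "norm (?W ** (F ** C)) \<le> (mat_norm R + p * (mat_norm B)\<^sup>2) * mat_norm C" .
  qed (use t0 \<tau> mat_norm_nonneg in auto)
  finally have 1: "\<bar>(E ** C) \<bullet> (?W ** (F ** C) ** ?X)\<bar>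
      \<le> \<tau> * ((mat_norm R + p * (mat_norm B)\<^sup>2) * (mat_norm C)\<^sup>2)"
    by (simp add: power2_eq_square mult_ac)
  have 2: "\<bar>(value_deriv K G ** (B ** (H ** C))) \<bullet> (cl K ** ?X)\<bar> \<le> \<tau> * (zeta p * p * mat_norm B * mat_norm C)"
    if G: "norm G = 1" and H: "norm H = 1" for G H
  proof -
    have "\<bar>(value_deriv K G ** (B ** (H ** C))) \<bullet> (cl K ** ?X)\<bar>
        \<le> trace ?X * norm (value_deriv K G ** (B ** (H ** C)))"
      using inner_psd_le[OF psd] inner_state_covariance_le[OF stable_cl[OF K] psd_if_pos_def[OF moment]]
      by (simp add: covar_def)
    also have "\<dots> \<le> \<tau> * (zeta p * p * (mat_norm B * mat_norm C))"
    proof (intro mult_mono \<tau>)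
      have "norm (value_deriv K G ** (B ** (H ** C))) \<le> mat_norm (value_deriv K G) * norm (B ** (H ** C))"
        by (rule norm_matrix_mult_left)
      also have "\<dots> \<le> (zeta p * p) * (mat_norm B * mat_norm C)"
      proof (intro mult_mono mat_norm_value_deriv K p)
        show "mat_norm G \<le> 1" using mat_norm_le_norm[of G] G by simp
        have "norm (B ** (H ** C)) \<le> mat_norm B * norm (H ** C)" by (rule norm_matrix_mult_left)
        also have "\<dots> \<le> mat_norm B * mat_norm C" by (intro mult_left_mono EC H mat_norm_nonneg)
        finally show "norm (B ** (H ** C)) \<le> mat_norm B * mat_norm C" .
      qed (use z p0 in auto)
      finally show "norm (value_deriv K G ** (B ** (H ** C))) \<le> zeta p * p * (mat_norm B * mat_norm C)" .
    qed (use t0 \<tau> in auto)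
    finally show ?thesis by (simp add: mult.assoc)
  qed
  have "\<bar>E \<bullet> grad_deriv K F\<bar> \<le> 2 * \<bar>(E ** C) \<bullet> (?W ** (F ** C) ** ?X)\<bar>
      + 2 * \<bar>(value_deriv K F ** (B ** (E ** C))) \<bullet> (cl K ** ?X)\<bar>
      + 2 * \<bar>(value_deriv K E ** (B ** (F ** C))) \<bullet> (cl K ** ?X)\<bar>"
    unfolding inner_grad_deriv[OF K] by linarith
  also have "\<dots> \<le> 2 * (\<tau> * ((mat_norm R + p * (mat_norm B)\<^sup>2) * (mat_norm C)\<^sup>2))
      + 2 * (\<tau> * (zeta p * p * mat_norm B * mat_norm C)) + 2 * (\<tau> * (zeta p * p * mat_norm B * mat_norm C))"
    by (intro add_mono mult_left_mono 1 2 E F) auto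
  finally show ?thesis by (simp add: algebra_simps)
qed

end

section \<open>Vectorization and the Hessian matrix\<close>

lemma linear_vectorize: "linear vectorize"
  by (intro linearI) (simp_all add: vectorize_def vec_eq_iff)

lemma linear_unvectorize: "linear unvectorize"
  by (intro linearI) (simp_all add: unvectorize_def vec_eq_iff)

lemma inner_vectorize: "vectorize K \<bullet> v = K \<bullet> unvectorize v"
proof -
  have "vectorize K \<bullet> v = (\<Sum>(j, i)\<in>UNIV \<times> UNIV. K $ i $ j * v $ (j, i))"
    by (simp add: inner_vec_def vectorize_def case_prod_beta)
  also have "\<dots> = (\<Sum>j\<in>UNIV. \<Sum>i\<in>UNIV. K $ i $ j * v $ (j, i))"
    by (rule sum.cartesian_product[symmetric])
  also have "\<dots> = K \<bullet> unvectorize v"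
    unfolding inner_vec_def unvectorize_def by simp (rule sum.swap)
  finally show ?thesis .
qed

lemma norm_unvectorize: "norm (unvectorize v) = norm v"
  using inner_vectorize[of "unvectorize v" v] by (simp add: norm_eq_sqrt_inner)

lemma bounded_linear_vectorize: "bounded_linear vectorize"
  and bounded_linear_unvectorize: "bounded_linear unvectorize"
  using linear_vectorize linear_unvectorize by (simp_all add: linear_conv_bounded_linear)

context sof begin

text \<open>The gradient field in the definition is the vectorized \<open>grad\<close>, a gradient
  of the cost at stabilizing gains; their neighbourhood is pulled back through
  \<open>unvectorize\<close>.\<close>

lemma has_hessian_cost:
  assumes K: "K \<in> stabilizing A B C"
  shows "has_hessian (\<lambda>v. cost (unvectorize v))
    (matrix (\<lambda>v. vectorize (grad_deriv K (unvectorize v)))) (vectorize K)"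
  unfolding has_hessian_def
proof (intro exI conjI)
  let ?g = "\<lambda>v. vectorize (grad (unvectorize v))" and ?h = "\<lambda>v. vectorize (grad_deriv K (unvectorize v))"
  have "((\<lambda>v. grad (unvectorize v)) has_derivative (\<lambda>v. grad_deriv K (unvectorize v))) (at (vectorize K))"
    using K by (intro has_derivative_compose[OF bounded_linear_imp_has_derivative[OF bounded_linear_unvectorize]])
      (simp add: grad_has_derivative)
  then have D: "(?g has_derivative ?h) (at (vectorize K))"
    by (rule bounded_linear.has_derivative[OF bounded_linear_vectorize])
  then have "linear ?h" by (intro bounded_linear.linear has_derivative_bounded_linear)
  then have "(*v) (matrix ?h) = ?h" by (simp add: fun_eq_iff matrix_works linear_matrix_vector_mul_eq)
  with D show "(?g has_derivative (\<lambda>v. matrix ?h *v v)) (at (vectorize K))" by simp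
  have "isCont unvectorize (vectorize K)"
    by (intro linear_continuous_at bounded_linear_unvectorize)
  then have "filterlim unvectorize (nhds K) (nhds (vectorize K))"
    unfolding isCont_def tendsto_at_iff_tendsto_nhds by simp
  then have "\<forall>\<^sub>F v in nhds (vectorize K). unvectorize v \<in> stabilizing A B C"
    using eventually_stabilizing[OF K] by (rule eventually_compose_filterlim[rotated])
  then show "\<forall>\<^sub>F v in nhds (vectorize K). ((\<lambda>v. cost (unvectorize v)) has_derivative (\<lambda>h. ?g v \<bullet> h)) (at v)"
  proof eventually_elim
    case (elim v)
    have "((\<lambda>v. cost (unvectorize v)) has_derivative (\<lambda>h. grad (unvectorize v) \<bullet> unvectorize h)) (at v)"
      by (rule has_derivative_compose[OF bounded_linear_imp_has_derivative[OF bounded_linear_unvectorize]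
            cost_has_derivative[OF elim]])
    then show ?case by (simp add: inner_vectorize)
  qed
qed

lemma hessian_cost_bound:
  assumes K: "K \<in> stabilizing A B C" and p: "mat_norm (value_mat K) \<le> p"
    and \<tau>: "trace (covar K) \<le> \<tau>"
  shows "mat_norm (hessian (\<lambda>v. cost (unvectorize v)) (vectorize K)) \<le>
    2 * \<tau> * ((mat_norm R + p * (mat_norm B)\<^sup>2) * (mat_norm C)\<^sup>2 + 2 * (zeta p * p * mat_norm B * mat_norm C))"
  unfolding hessian_eqI[OF has_hessian_cost[OF K]]
proof (rule mat_norm_leI_unit)
  fix x y :: "real^('d \<times> 'm)"
  assume 1: "norm x = 1" "norm y = 1"
  let ?h = "\<lambda>v. vectorize (grad_deriv K (unvectorize v))"
  have "linear (grad_deriv K)"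
    using grad_has_derivative[OF K] by (intro bounded_linear.linear has_derivative_bounded_linear)
  then have "linear ?h"
    using linear_compose[OF linear_compose[OF linear_unvectorize] linear_vectorize]
    by (simp add: o_def)
  then have "matrix ?h *v y = ?h y" by (simp add: matrix_works linear_matrix_vector_mul_eq)
  then have "x \<bullet> (matrix ?h *v y) = unvectorize x \<bullet> grad_deriv K (unvectorize y)"
    using inner_vectorize[of "grad_deriv K (unvectorize y)" x] by (simp add: inner_commute)
  then show "\<bar>x \<bullet> (matrix ?h *v y)\<bar> \<le> 2 * \<tau> * ((mat_norm R + p * (mat_norm B)\<^sup>2) * (mat_norm C)\<^sup>2
      + 2 * (zeta p * p * mat_norm B * mat_norm C))"
    using inner_grad_deriv_bound[OF K p \<tau>, of "unvectorize x" "unvectorize y"] 1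
    by (simp add: norm_unvectorize)
qed

end

theorem lemma5:
  fixes A :: "real^'n^'n" and B :: "real^'m^'n" and C :: "real^'n^'d"
    and Q :: "real^'n^'n" and R :: "real^'m^'m"
    and D :: "(real^'n) measure"
    and Kstar K :: "real^'d^'m" and \<alpha> :: real
  assumes "controllable A B" and "observable C A" and "lin_indep_rows C"
    and "pos_def_mat Q" and "pos_def_mat R"
    and "prob_space D" and "sets D = sets borel"
    and "integrable D outer_square" and "pos_def_mat (second_moment D)"
    and "Kstar \<in> stabilizing A B C"
    and "\<forall>K' \<in> stabilizing A B C. sof_cost D A B C Q R Kstar \<le> sof_cost D A B C Q R K'"
    and "\<alpha> \<ge> sof_cost D A B C Q R Kstar"
    and "K \<in> sublevel_gains D A B C Q R \<alpha>"
  shows "let J = (\<lambda>v. sof_cost D A B C Q R (unvectorize v));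
             \<mu> = sigma_min (second_moment D);
             \<zeta>\<^sub>1 = 1 / sigma_min Q *
                  (\<alpha> / \<mu> * (1 + (mat_norm B)\<^sup>2 * (mat_norm C)\<^sup>2) + mat_norm R * (mat_norm C)\<^sup>2) - 1;
             L = 2 * \<alpha> / sigma_min Q *
                 (mat_norm R + \<alpha> / \<mu> * (1 + 2 * \<zeta>\<^sub>1 / (mat_norm B * mat_norm C)) * (mat_norm B)\<^sup>2) *
                 (mat_norm C)\<^sup>2
         in has_hessian J (hessian J (vectorize K)) (vectorize K) \<and>
            mat_norm (hessian J (vectorize K)) \<le> L"
proof -
  interpret sof A B C Q R D
    using assms by unfold_locales
  let ?J = "\<lambda>v. cost (unvectorize v)" and ?p = "\<alpha> / sigma_min (second_moment D)"
  have K: "K \<in> stabilizing A B C" and \<alpha>: "cost K \<le> \<alpha>"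
    using assms(13) by (auto simp: sublevel_gains_def)
  have hess: "has_hessian ?J (hessian ?J (vectorize K)) (vectorize K)"
    using has_hessian_cost[OF K] hessian_eqI by metis
  have "mat_norm (hessian ?J (vectorize K)) \<le> 2 * (\<alpha> / sigma_min Q) *
      ((mat_norm R + ?p * (mat_norm B)\<^sup>2) * (mat_norm C)\<^sup>2 + 2 * (zeta ?p * ?p * mat_norm B * mat_norm C))"
    by (intro hessian_cost_bound K mat_norm_value_mat trace_covar \<alpha>)
  \<comment> \<open>The product |B| |C| cancels. If B or C is 0 the quotient is
    \<open>x / 0 = 0\<close>, and the factors |B|^2 and |C|^2 make both sides agree.\<close>
  also have "(mat_norm R + ?p * (mat_norm B)\<^sup>2) * (mat_norm C)\<^sup>2 + 2 * (zeta ?p * ?p * mat_norm B * mat_norm C)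
      = (mat_norm R + ?p * (1 + 2 * zeta ?p / (mat_norm B * mat_norm C)) * (mat_norm B)\<^sup>2) * (mat_norm C)\<^sup>2"
    by (cases "mat_norm B = 0"; cases "mat_norm C = 0")
      (simp_all add: divide_simps, simp_all add: algebra_simps power2_eq_square)
  finally have bound: "mat_norm (hessian ?J (vectorize K)) \<le> 2 * \<alpha> / sigma_min Q *
      (mat_norm R + ?p * (1 + 2 * zeta ?p / (mat_norm B * mat_norm C)) * (mat_norm B)\<^sup>2) * (mat_norm C)\<^sup>2"
    by (simp add: mult.assoc)
  show ?thesis
    unfolding Let_def using hess bound[unfolded zeta_def] by blast
qed

end
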